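(* Let $d,n\ge 1$ and let $\varphi:\mathcal T_d\to M_n$ be a unital completely positive map with polynomial density $P_\varphi$. Then $\varphi$ is pure if and only if there exists a row polynomial $$Q(z)=\begin{pmatrix} q_1(z)&q_2(z)&\cdots&q_n(z)\end{pmatrix},\qquad q_j\in\mathbb C[z],$$ such that: (1) $\max_j \deg q_j=d-1$ and $P_\varphi(z)=Q(z)^*Q(z)$ for all $z\in\mathbb T$; and (2) all zeros (in $\mathbb C$) of the greatest common divisor $g_\varphi=\gcd(q_1,\ldots,q_n)$ lie on $\mathbb T$.
   Context: $\mathbb T$ is the unit circle in $\mathbb C$. $M_n=M_n(\mathbb C)$. $\mathcal T_d\subseteq M_d$ is the operator system of all $d\times d$ Toeplitz matrices $[a_{i-j}]_{i,j=0}^{d-1}$, $a_k\in\mathbb C$. $J\in M_d$ is the matrix with ones on the first superdiagonal and zeros elsewhere, so $\mathcal T_d=\operatorname{span}\{I,J,\ldots,J^{d-1},J^*,\ldots,(J^* )^{d-1}\}$. CP means completely positive, UCP means unital completely positive. For a linear map $\varphi:\mathcal T_d\to M_n$, its polynomial density is the $M_n$-valued trigonometric polynomial $$P_\varphi(z)=\varphi(I)+\sum_{k=1}^{d-1}\varphi(J^k)z^k+\sum_{k=1}^{d-1}\varphi((J^* )^k)z^{-k},\qquad z\in\mathbb T.$$ For CP maps $\psi,\varphi:\mathcal T_d\to M_n$ write $\psi\le_{\mathrm{cp}}\varphi$ if $\varphi-\psi$ is CP. A nonzero CP map $\varphi$ is pure if every CP map $\psi$ with $\psi\le_{\mathrm{cp}}\varphi$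 is of the form $\psi=t\varphi$ for some $t\in[0,1]$. For $Q$ a row polynomial, $Q(z)^*Q(z)$ is the $n\times n$ matrix with $(i,j)$ entry $\overline{q_i(z)}q_j(z)$. The greatest common divisor of polynomials not all zero is determined up to a nonzero scalar. *)

theory Defs
  imports
    "Jordan_Normal_Form.Schur_Decomposition"
    "HOL-Computational_Algebra.Polynomial_Factorial"
    "HOL-Computational_Algebra.Field_as_Ring"
begin

definition toeplitz :: "nat \<Rightarrow> complex mat set" where
  "toeplitz d = {mat d d (\<lambda>(i, j). a (int i - int j)) | a :: int \<Rightarrow> complex. True}"

definition shift_mat :: "nat \<Rightarrow> complex mat" where
  "shift_mat d = mat d d (\<lambda>(i, j). if j = i + 1 then 1 else 0)"

text \<open>In the order on the complex numbers, \<open>0 \<le> z\<close> means that \<open>z\<close> is real and nonnegative;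
  hence a matrix that is positive semidefinite in this sense is automatically Hermitian.\<close>

definition psd_mat :: "nat \<Rightarrow> complex mat \<Rightarrow> bool" where
  "psd_mat m A \<longleftrightarrow> A \<in> carrier_mat m m \<and> (\<forall>v \<in> carrier_vec m. 0 \<le> (A *\<^sub>v v) \<bullet>c v)"

text \<open>Identification of a \<open>k\<close> by \<open>k\<close> matrix \<open>X\<close> over the \<open>m\<close> by \<open>m\<close> matrices with a
  matrix of size \<open>k * m\<close>. Only the blocks \<open>X p q\<close> with \<open>p, q < k\<close> matter.\<close>

definition block_mat :: "nat \<Rightarrow> nat \<Rightarrow> (nat \<Rightarrow> nat \<Rightarrow> complex mat) \<Rightarrow> complex mat" where
  "block_mat k m X =
     mat (k * m) (k * m) (\<lambda>(i, j). X (i div m) (j div m) $$ (i mod m, j mod m))"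

text \<open>A map defined on the Toeplitz matrices is represented by a function on all matrices whose
  values outside \<open>toeplitz d\<close> are irrelevant; all notions below only inspect it on
  \<open>toeplitz d\<close>.\<close>

definition toeplitz_linear :: "nat \<Rightarrow> nat \<Rightarrow> (complex mat \<Rightarrow> complex mat) \<Rightarrow> bool" where
  "toeplitz_linear d n \<phi> \<longleftrightarrow>
     (\<forall>A \<in> toeplitz d. \<phi> A \<in> carrier_mat n n) \<and>
     (\<forall>A \<in> toeplitz d. \<forall>B \<in> toeplitz d. \<phi> (A + B) = \<phi> A + \<phi> B) \<and>
     (\<forall>c. \<forall>A \<in> toeplitz d. \<phi> (c \<cdot>\<^sub>m A) = c \<cdot>\<^sub>m \<phi> A)"

definition cp_map :: "nat \<Rightarrow> nat \<Rightarrow> (complex mat \<Rightarrow> complex mat) \<Rightarrow> bool" where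
  "cp_map d n \<phi> \<longleftrightarrow>
     toeplitz_linear d n \<phi> \<and>
     (\<forall>k X. (\<forall>p < k. \<forall>q < k. X p q \<in> toeplitz d) \<longrightarrow> psd_mat (k * d) (block_mat k d X) \<longrightarrow>
        psd_mat (k * n) (block_mat k n (\<lambda>p q. \<phi> (X p q))))"

definition ucp_map :: "nat \<Rightarrow> nat \<Rightarrow> (complex mat \<Rightarrow> complex mat) \<Rightarrow> bool" where
  "ucp_map d n \<phi> \<longleftrightarrow> cp_map d n \<phi> \<and> \<phi> (1\<^sub>m d) = 1\<^sub>m n"

definition cp_le ::
  "nat \<Rightarrow> nat \<Rightarrow> (complex mat \<Rightarrow> complex mat) \<Rightarrow> (complex mat \<Rightarrow> complex mat) \<Rightarrow> bool" where
  "cp_le d n \<psi> \<phi> \<longleftrightarrow> cp_map d n (\<lambda>A. \<phi> A - \<psi> A)"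

definition pure_cp_map :: "nat \<Rightarrow> nat \<Rightarrow> (complex mat \<Rightarrow> complex mat) \<Rightarrow> bool" where
  "pure_cp_map d n \<phi> \<longleftrightarrow>
     cp_map d n \<phi> \<and> (\<exists>A \<in> toeplitz d. \<phi> A \<noteq> 0\<^sub>m n n) \<and>
     (\<forall>\<psi>. cp_map d n \<psi> \<and> cp_le d n \<psi> \<phi> \<longrightarrow>
        (\<exists>t::real. 0 \<le> t \<and> t \<le> 1 \<and>
           (\<forall>A \<in> toeplitz d. \<psi> A = complex_of_real t \<cdot>\<^sub>m \<phi> A)))"

definition poly_density ::
  "nat \<Rightarrow> nat \<Rightarrow> (complex mat \<Rightarrow> complex mat) \<Rightarrow> complex \<Rightarrow> complex mat" where
  "poly_density d n \<phi> z = mat n n (\<lambda>(i, j).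
     \<phi> (1\<^sub>m d) $$ (i, j)
     + (\<Sum>k = 1..d - 1. \<phi> (shift_mat d ^\<^sub>m k) $$ (i, j) * z ^ k)
     + (\<Sum>k = 1..d - 1. \<phi> (mat_adjoint (shift_mat d) ^\<^sub>m k) $$ (i, j) * z powi (- int k)))"

text \<open>A row polynomial with \<open>n\<close> entries is a matrix in \<open>carrier_mat 1 n\<close> over the polynomials.\<close>

definition eval_row :: "complex poly mat \<Rightarrow> complex \<Rightarrow> complex mat" where
  "eval_row Q z = map_mat (\<lambda>q. poly q z) Q"

text \<open>The zero polynomial has degree \<open>0\<close> here, so statements about the maximal degree
  need \<open>Q\<close> to be nonzero in order to match the convention that it has degree minus infinity.\<close>

definition row_degree :: "complex poly mat \<Rightarrow> nat" where
  "row_degree Q = Max {degree (Q $$ (0, j)) | j. j < dim_col Q}"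

definition row_gcd :: "complex poly mat \<Rightarrow> complex poly" where
  "row_gcd Q = Gcd {Q $$ (0, j) | j. j < dim_col Q}"

end

theory Submission
  imports Defs "HOL-Library.Function_Algebras"
    "HOL-Computational_Algebra.Fundamental_Theorem_Algebra"
begin

text \<open>A completely positive map \<open>\<phi>\<close> on the Toeplitz matrices is encoded by the functional
  \<open>X \<mapsto> \<Sum>p q. \<phi> (X p q) $$ (p, q)\<close> on block Toeplitz matrices. The M. Riesz
  extension argument extends it to a positive functional on all matrices, which is given by a positive
  semidefinite matrix; splitting that matrix into rank one summands writes \<open>\<phi>\<close> as a finite
  sum of compressions \<open>A \<mapsto> V\<^sup>* A V\<close>, each of which has density
  \<open>Q\<^sup>* Q\<close> for the row polynomial \<open>Q\<close> whose coefficients are the rows of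
  \<open>V\<close>.

  If \<open>\<phi>\<close> is pure, one summand suffices. If moreover all entries had degree below
  \<open>d - 1\<close>, or a common zero \<open>\<alpha>\<close> off the circle, then
  \<open>Q = u Q'\<close> where \<open>u\<close> is \<open>1\<close> or \<open>z - \<alpha>\<close> and
  \<open>deg Q' \<le> d - 2\<close>, and on the circle \<open>\<bar>u\<bar>\<^sup>2\<close> is a sum of two squares of
  polynomials of degree at most one that are not proportional to it; this splits \<open>\<phi>\<close>.

  Conversely, if \<open>\<phi>\<close> has density \<open>Q\<^sup>* Q\<close> and \<open>h\<close> is a row occurring in
  a map below \<open>\<phi>\<close>, then \<open>h\<^sup>* h \<le> Q\<^sup>* Q\<close> on the circle. Hence
  \<open>h\<close> is pointwise proportional to \<open>Q\<close>, that is \<open>g h = r Q\<close> with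
  \<open>g\<close> the greatest common divisor of \<open>Q\<close> and \<open>\<bar>r\<bar> \<le> \<bar>g\<bar>\<close> on the circle.
  Since all zeros of \<open>g\<close> lie on the circle, \<open>g\<close> divides \<open>r\<close>, and
  comparing degrees the quotient is constant.\<close>

section \<open>Extension of positive functionals\<close>

text \<open>Linearity over the reals and positivity on the cone \<open>K\<close> are demanded on the
  subspace \<open>S\<close> only. The function \<open>f\<close> itself is total, so an extension is
  another function that agrees with it on \<open>S\<close>.\<close>

definition positive_functional_on :: "'v::real_vector set \<Rightarrow> 'v set \<Rightarrow> ('v \<Rightarrow> real) \<Rightarrow> bool" where
  "positive_functional_on K S f \<longleftrightarrow> subspace S \<and>
     (\<forall>x\<in>S. \<forall>y\<in>S. f (x + y) = f x + f y) \<and> (\<forall>c. \<forall>x\<in>S. f (c *\<^sub>R x) = c * f x) \<and>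
     (\<forall>x\<in>S \<inter> K. 0 \<le> f x)"

text \<open>One step of the M. Riesz extension. In the order given by \<open>K\<close>, the value at
  \<open>b\<close> has to lie above every \<open>f x\<close> with \<open>x\<close> below
  \<open>b\<close> and below every \<open>f y\<close> with \<open>y\<close> above \<open>b\<close>.
  Additivity of \<open>K\<close> makes these bounds compatible, \<open>lower\<close> and
  \<open>upper\<close> make both families nonempty, and the supremum \<open>\<gamma>\<close> of the
  lower bounds is an admissible value.\<close>

lemma positive_functional_extend_insert:
  fixes K S :: "'v::real_vector set"
  assumes f: "positive_functional_on K S f"
    and K_add: "\<And>x y. x \<in> K \<Longrightarrow> y \<in> K \<Longrightarrow> x + y \<in> K"
    and K_scale: "\<And>c x. 0 \<le> c \<Longrightarrow> x \<in> K \<Longrightarrow> c *\<^sub>R x \<in> K"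
    and lower: "\<exists>x\<in>S. b - x \<in> K" and upper: "\<exists>y\<in>S. y - b \<in> K"
  shows "\<exists>f'. positive_functional_on K (span (insert b S)) f' \<and> (\<forall>x\<in>S. f' x = f x)"
proof (cases "b \<in> S")
  case True
  then have "span (insert b S) = S"
    using f by (simp add: positive_functional_on_def insert_absorb span_eq_iff)
  then show ?thesis using f by metis
next
  case False
  have S: "subspace S" and add: "\<And>x y. x \<in> S \<Longrightarrow> y \<in> S \<Longrightarrow> f (x + y) = f x + f y"
    and scale: "\<And>c x. x \<in> S \<Longrightarrow> f (c *\<^sub>R x) = c * f x"
    and pos: "\<And>x. x \<in> S \<Longrightarrow> x \<in> K \<Longrightarrow> 0 \<le> f x"
    using f by (auto simp: positive_functional_on_def)
  have diff: "f (x - y) = f x - f y" if "x \<in> S" "y \<in> S" for x y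
    using add[of x "(-1) *\<^sub>R y"] scale[of y "-1"] that S by (simp add: subspace_neg)
  define \<gamma> where "\<gamma> = (SUP x\<in>{x\<in>S. b - x \<in> K}. f x)"
  have mono: "f x \<le> f y" if "x \<in> S" "b - x \<in> K" "y \<in> S" "y - b \<in> K" for x y
  proof -
    have "(b - x) + (y - b) \<in> K" using that by (intro K_add)
    then have "0 \<le> f (y - x)" using that S by (intro pos) (auto simp: subspace_diff)
    then show ?thesis using diff that by simp
  qed
  obtain y0 where "y0 \<in> S" "y0 - b \<in> K" using upper by blast
  then have bdd: "bdd_above (f ` {x\<in>S. b - x \<in> K})"
    by (intro bdd_aboveI[of _ "f y0"]) (auto intro: mono)
  have ge: "f x \<le> \<gamma>" if "x \<in> S" "b - x \<in> K" for x
    unfolding \<gamma>_def using that by (intro cSUP_upper bdd) auto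
  have le: "\<gamma> \<le> f y" if "y \<in> S" "y - b \<in> K" for y
    unfolding \<gamma>_def using that lower by (intro cSUP_least) (auto intro: mono)
  \<comment> \<open>The coefficient of \<open>b\<close>, well defined on the larger span because
    \<open>b \<notin> S\<close>.\<close>
  define t where "t z = (THE k. z - k *\<^sub>R b \<in> S)" for z
  have t: "t (x + k *\<^sub>R b) = k" if "x \<in> S" for x k
    unfolding t_def
  proof (rule the_equality)
    show "x + k *\<^sub>R b - k *\<^sub>R b \<in> S" using that by simp
    fix l assume "x + k *\<^sub>R b - l *\<^sub>R b \<in> S"
    then have "x + k *\<^sub>R b - l *\<^sub>R b - x \<in> S" using that S by (rule subspace_diff[rotated])
    then have "(k - l) *\<^sub>R b \<in> S" by (simp add: algebra_simps)
    then have "inverse (k - l) *\<^sub>R (k - l) *\<^sub>R b \<in> S" using S by (rule subspace_scale[rotated])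
    then show "l = k" using False by (cases "k = l") auto
  qed
  define f' where "f' z = f (z - t z *\<^sub>R b) + t z * \<gamma>" for z
  have f': "f' (x + k *\<^sub>R b) = f x + k * \<gamma>" if "x \<in> S" for x k
    unfolding f'_def t[OF that] by simp
  have span: "\<exists>x\<in>S. \<exists>k. z = x + k *\<^sub>R b" if z: "z \<in> span (insert b S)" for z
  proof -
    from span_breakdown_eq[of z b S] z S obtain k where "z - k *\<^sub>R b \<in> S"
      by (auto simp: span_eq_iff[THEN iffD2])
    then show ?thesis by (intro bexI[of _ "z - k *\<^sub>R b"] exI[of _ k]) auto
  qed
  have "0 \<le> f x + k * \<gamma>" if x: "x \<in> S" and K: "x + k *\<^sub>R b \<in> K" for x k
  proof -
    \<comment> \<open>Dividing by |k| turns membership in \<open>K\<close> into a comparison of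
      \<open>b\<close> with the multiple -x/k in \<open>S\<close>: that multiple lies below
      \<open>b\<close> if \<open>k > 0\<close> and above \<open>b\<close> if
      \<open>k < 0\<close>.\<close>
    consider "k = 0" | "k > 0" | "k < 0" by linarith
    then show ?thesis
    proof cases
      case 1 then show ?thesis using pos x K by simp
    next
      case 2
      have "b - (- inverse k) *\<^sub>R x = inverse k *\<^sub>R (x + k *\<^sub>R b)"
        using 2 by (simp add: algebra_simps)
      then have "f ((- inverse k) *\<^sub>R x) \<le> \<gamma>"
        using x S K 2 by (intro ge) (auto intro: K_scale subspace_scale subspace_neg)
      then have "k * f ((- inverse k) *\<^sub>R x) \<le> k * \<gamma>" using 2 by (intro mult_left_mono) auto
      moreover have "k * f ((- inverse k) *\<^sub>R x) = - f x"
        unfolding scale[OF x] using 2 by simp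
      ultimately show ?thesis by linarith
    next
      case 3
      have "(- inverse k) *\<^sub>R x - b = (- inverse k) *\<^sub>R (x + k *\<^sub>R b)"
        using 3 by (simp add: algebra_simps)
      moreover have "(- inverse k) *\<^sub>R (x + k *\<^sub>R b) \<in> K"
        using 3 K by (intro K_scale) (auto simp: field_simps)
      ultimately have "\<gamma> \<le> f ((- inverse k) *\<^sub>R x)"
        using x S by (intro le) (auto intro: subspace_scale subspace_neg)
      then have "k * f ((- inverse k) *\<^sub>R x) \<le> k * \<gamma>" using 3 by (intro mult_left_mono_neg) auto
      moreover have "k * f ((- inverse k) *\<^sub>R x) = - f x" unfolding scale[OF x] using 3 by simp
      ultimately show ?thesis by linarith
    qed
  qed
  then have "\<forall>z\<in>span (insert b S) \<inter> K. 0 \<le> f' z"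
    using span f' by (metis Int_iff)
  moreover have "f' (y + z) = f' y + f' z"
    if yz: "y \<in> span (insert b S)" "z \<in> span (insert b S)" for y z
  proof -
    obtain x k x' k' where "x \<in> S" "x' \<in> S" "y = x + k *\<^sub>R b" "z = x' + k' *\<^sub>R b"
      using span yz by metis
    moreover from this have "y + z = (x + x') + (k + k') *\<^sub>R b"
      by (simp add: algebra_simps)
    ultimately show ?thesis using S by (simp only: f' subspace_add add) (simp add: algebra_simps)
  qed
  moreover have "f' (c *\<^sub>R z) = c * f' z" if z: "z \<in> span (insert b S)" for c z
  proof -
    obtain x k where "x \<in> S" "z = x + k *\<^sub>R b" using span z by metis
    moreover from this have "c *\<^sub>R z = c *\<^sub>R x + (c * k) *\<^sub>R b"
      by (simp add: algebra_simps)
    ultimately show ?thesis using S by (simp only: f' subspace_scale scale) (simp add: algebra_simps)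
  qed
  moreover have "f' x = f x" if "x \<in> S" for x using f'[OF that, of 0] by simp
  ultimately show ?thesis unfolding positive_functional_on_def
    by (intro exI[of _ f']) (auto simp: subspace_span)
qed

text \<open>The elements of \<open>B\<close> are adjoined one at a time; their bounds lie in
  \<open>S\<close> and hence in every intermediate span.\<close>

lemma positive_functional_extend_finite:
  fixes K S B :: "'v::real_vector set"
  assumes "finite B" and f: "positive_functional_on K S f"
    and K_add: "\<And>x y. x \<in> K \<Longrightarrow> y \<in> K \<Longrightarrow> x + y \<in> K"
    and K_scale: "\<And>c x. 0 \<le> c \<Longrightarrow> x \<in> K \<Longrightarrow> c *\<^sub>R x \<in> K"
    and "\<And>b. b \<in> B \<Longrightarrow> \<exists>x\<in>S. b - x \<in> K" and "\<And>b. b \<in> B \<Longrightarrow> \<exists>y\<in>S. y - b \<in> K"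
  shows "\<exists>f'. positive_functional_on K (span (B \<union> S)) f' \<and> (\<forall>x\<in>S. f' x = f x)"
  using assms(1,5,6)
proof (induction B rule: finite_induct)
  case empty
  have eq: "span ({} \<union> S) = S" using f by (simp add: positive_functional_on_def span_eq_iff)
  show ?case unfolding eq using f by (intro exI[of _ f]) simp
next
  case (insert b B)
  then obtain g where g: "positive_functional_on K (span (B \<union> S)) g" "\<forall>x\<in>S. g x = f x" by auto
  have sub: "S \<subseteq> span (B \<union> S)" using span_superset[of "B \<union> S"] by blast
  have "\<exists>x\<in>span (B \<union> S). b - x \<in> K" "\<exists>y\<in>span (B \<union> S). y - b \<in> K"
    using insert.prems sub by blast+
  from positive_functional_extend_insert[OF g(1) K_add K_scale this]
  obtain h where h: "positive_functional_on K (span (insert b (span (B \<union> S)))) h"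
    "\<forall>x\<in>span (B \<union> S). h x = g x" by blast
  have "span (insert b (span (B \<union> S))) = span (insert b B \<union> S)"
  proof (rule antisym)
    show "span (insert b (span (B \<union> S))) \<subseteq> span (insert b B \<union> S)"
      using span_mono[of "B \<union> S" "insert b B \<union> S"]
      by (intro span_minimal) (auto simp: span_base subspace_span)
    show "span (insert b B \<union> S) \<subseteq> span (insert b (span (B \<union> S)))"
      by (intro span_mono) (auto simp: span_base)
  qed
  moreover have "\<forall>x\<in>S. h x = f x" using h(2) g(2) sub by auto
  ultimately show ?case using h(1) by auto
qed

section \<open>Positive semidefinite kernels\<close>

text \<open>The value v^* G v. General index sets allow block matrices to be indexed directly by
  pairs of block and position.\<close>

definition sesq :: "'a set \<Rightarrow> ('a \<Rightarrow> 'a \<Rightarrow> complex) \<Rightarrow> ('a \<Rightarrow> complex) \<Rightarrow> complex" where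
  "sesq I G v = (\<Sum>i\<in>I. \<Sum>j\<in>I. cnj (v i) * G i j * v j)"

definition psd_on :: "'a set \<Rightarrow> ('a \<Rightarrow> 'a \<Rightarrow> complex) \<Rightarrow> bool" where
  "psd_on I G \<longleftrightarrow> (\<forall>v. 0 \<le> sesq I G v)"

text \<open>Changing a single coordinate supplies both the test vectors with one or two nonzero
  entries and the completed square in the Schur complement.\<close>

lemma sesq_shift:
  assumes "finite I" "i \<in> I"
  shows "sesq I G (\<lambda>x. v x + (if x = i then c else 0)) =
    sesq I G v + c * (\<Sum>k\<in>I. cnj (v k) * G k i) + cnj c * (\<Sum>l\<in>I. G i l * v l) + c * cnj c * G i i"
proof -
  define e where "e x = (if x = i then c else 0)" for x
  have right: "(\<Sum>l\<in>I. a l * e l) = a i * c" for a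
    using assms by (simp add: e_def if_distrib[of "\<lambda>x. _ * x"] sum.delta' cong: if_cong)
  have left: "(\<Sum>k\<in>I. cnj (e k) * a k) = cnj c * a i" for a
    using assms by (simp add: e_def if_distrib[of "\<lambda>x. x * _"] if_distrib[of cnj] sum.delta' cong: if_cong)
  have "sesq I G (\<lambda>x. v x + e x) = sesq I G v + (\<Sum>k\<in>I. \<Sum>l\<in>I. (cnj (v k) * G k l) * e l)
      + (\<Sum>k\<in>I. cnj (e k) * (\<Sum>l\<in>I. G k l * v l)) + (\<Sum>k\<in>I. cnj (e k) * (\<Sum>l\<in>I. G k l * e l))"
    by (simp add: sesq_def sum.distrib algebra_simps sum_distrib_left)
  also have "\<dots> = sesq I G v + c * (\<Sum>k\<in>I. cnj (v k) * G k i) + cnj c * (\<Sum>l\<in>I. G i l * v l)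
      + c * cnj c * G i i"
    unfolding right left by (simp add: sum_distrib_left algebra_simps)
  finally show ?thesis unfolding e_def .
qed

lemma sesq_zero [simp]: "sesq I G (\<lambda>_. 0) = 0"
  by (simp add: sesq_def)

lemma sesq_single:
  assumes "finite I" "i \<in> I"
  shows "sesq I G (\<lambda>x. if x = i then c else 0) = c * cnj c * G i i"
  using sesq_shift[OF assms, of G "\<lambda>_. 0" c] by simp

lemma sesq_pair:
  assumes "finite I" "i \<in> I" "k \<in> I"
  shows "sesq I G (\<lambda>x. (if x = k then 1 else 0) + (if x = i then c else 0)) =
    G k k + c * G k i + cnj c * G i k + c * cnj c * G i i"
proof -
  have 1: "(\<Sum>x\<in>I. cnj (if x = k then 1 else 0) * a x) = a k" for a
    using assms by (simp add: if_distrib[of "\<lambda>x. x * _"] if_distrib[of cnj] sum.delta' cong: if_cong)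
  have 2: "(\<Sum>x\<in>I. a x * (if x = k then 1 else 0)) = a k" for a :: "'a \<Rightarrow> complex"
    using assms by (simp add: if_distrib[of "\<lambda>x. _ * x"] sum.delta' cong: if_cong)
  show ?thesis using assms unfolding sesq_shift[OF assms(1,2)] sesq_single[OF assms(1,3)] 1 2 by simp
qed

lemma psd_on_diag:
  assumes "finite I" "psd_on I G" "i \<in> I" shows "0 \<le> G i i"
proof -
  have "0 \<le> sesq I G (\<lambda>x. if x = i then 1 else 0)" using assms(2) unfolding psd_on_def by blast
  then show ?thesis unfolding sesq_single[OF assms(1,3)] by simp
qed

lemma psd_on_pair:
  assumes "finite I" "psd_on I G" "i \<in> I" "k \<in> I"
  shows "0 \<le> G k k + c * G k i + cnj c * G i k + c * cnj c * G i i"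
  unfolding sesq_pair[OF assms(1,3,4), symmetric] using assms(2) unfolding psd_on_def by blast

text \<open>Polarization: nonnegative values are real, and reality of the form at e_k + c e_i for c
  = 1 and c = i settles the imaginary and the real part.\<close>

lemma psd_on_hermitian:
  assumes "finite I" "psd_on I G" "i \<in> I" "k \<in> I" shows "G i k = cnj (G k i)"
proof -
  note * = psd_on_pair[OF assms]
  have "Im (G k k) = 0" "Im (G i i) = 0" using psd_on_diag[OF assms(1,2)] assms(3,4)
    by (auto simp: less_eq_complex_def)
  with *[of 1] *[of \<i>] have "Im (G k i + G i k) = 0" "Re (G k i - G i k) = 0"
    by (auto simp: less_eq_complex_def)
  then show ?thesis by (simp add: complex_eq_iff)
qed

text \<open>With \<open>G i i = 0\<close> the form at e_k + c e_i has no quadratic term in c, so it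
  is unbounded below unless its linear part vanishes.\<close>

lemma psd_on_zero_diag:
  assumes "finite I" "psd_on I G" "i \<in> I" "k \<in> I" "G i i = 0" shows "G k i = 0"
proof (rule ccontr)
  assume nz: "G k i \<noteq> 0"
  define r where "r = (Re (G k i))\<^sup>2 + (Im (G k i))\<^sup>2"
  have r: "r > 0" using nz by (auto simp: r_def complex_eq_iff sum_power2_gt_zero_iff)
  \<comment> \<open>Chosen so that the real part of the form becomes -1; \<open>r\<close> is the
    squared modulus of \<open>G k i\<close>.\<close>
  define t where "t = (Re (G k k) + 1) / (2 * r)"
  have "0 \<le> G k k + c * G k i + cnj c * G i k" for c
    using psd_on_pair[OF assms(1-4), of c] assms(5) by simp
  from this[of "- of_real t * cnj (G k i)"] have "0 \<le> Re (G k k) - 2 * t * r"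
    unfolding psd_on_hermitian[OF assms(1-4)]
    by (simp add: less_eq_complex_def r_def power2_eq_square algebra_simps)
  moreover have "2 * t * r = Re (G k k) + 1" using r by (simp add: t_def)
  ultimately show False by simp
qed

text \<open>Completing the square: at \<open>v\<close>, the form of the Schur complement is the form
  of \<open>G\<close> at \<open>v\<close> with coordinate \<open>i\<close> shifted by
  \<open>- L / G i i\<close>.\<close>

lemma psd_on_schur_complement:
  assumes "finite I" "psd_on I G" "i \<in> I" "G i i \<noteq> 0"
  shows "psd_on I (\<lambda>k l. G k l - G k i * G i l / G i i)"
  unfolding psd_on_def
proof
  fix v
  define L where "L = (\<Sum>l\<in>I. G i l * v l)"
  define R where "R = (\<Sum>k\<in>I. cnj (v k) * G k i)"
  define c where "c = - L / G i i"
  have "R * L / G i i = (\<Sum>k\<in>I. \<Sum>l\<in>I. cnj (v k) * G k i * (G i l * v l)) / G i i"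
    by (simp add: L_def R_def sum_product)
  then have "sesq I (\<lambda>k l. G k l - G k i * G i l / G i i) v = sesq I G v - R * L / G i i"
    by (simp add: sesq_def algebra_simps sum_subtractf sum_divide_distrib)
  also have "\<dots> = sesq I G (\<lambda>x. v x + (if x = i then c else 0))"
    unfolding sesq_shift[OF assms(1,3)] L_def[symmetric] R_def[symmetric] using assms(4)
    by (simp add: c_def field_simps)
  also have "0 \<le> \<dots>" using assms(2) by (simp add: psd_on_def)
  finally show "0 \<le> sesq I (\<lambda>k l. G k l - G k i * G i l / G i i) v" .
qed

text \<open>Cholesky elimination. Splitting off the rank one kernel of a nonzero pivot
  \<open>i\<close> leaves a Schur complement with a zero at \<open>i\<close>, while zeros on the
  diagonal stay zero, so the number of nonzero diagonal entries drops. Once the diagonal vanishes,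
  so does the kernel.\<close>

lemma psd_on_sum_rank_one:
  assumes "finite I" "psd_on I G"
  shows "\<exists>(m::nat) g. \<forall>i\<in>I. \<forall>j\<in>I. G i j = (\<Sum>l<m. g l i * cnj (g l j))"
  using assms(2)
proof (induction "card {i\<in>I. G i i \<noteq> 0}" arbitrary: G rule: less_induct)
  case less
  show ?case
  proof (cases "\<exists>i\<in>I. G i i \<noteq> 0")
    case False
    then have "\<forall>i\<in>I. \<forall>j\<in>I. G i j = 0" using psd_on_zero_diag[OF assms(1) less.prems] by blast
    then show ?thesis by (intro exI[of _ 0]) simp
  next
    case True
    then obtain i where i: "i \<in> I" "G i i \<noteq> 0" by blast
    define H where "H k l = G k l - G k i * G i l / G i i" for k l
    have "{k\<in>I. H k k \<noteq> 0} \<subseteq> {k\<in>I. G k k \<noteq> 0} - {i}"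
    proof
      fix k assume k: "k \<in> {k\<in>I. H k k \<noteq> 0}"
      then have "k \<noteq> i" using i by (auto simp: H_def)
      moreover have "G k k \<noteq> 0"
      proof
        assume "G k k = 0"
        then have "G i k = 0" using psd_on_zero_diag[OF assms(1) less.prems, of k i] k i by auto
        then show False using k \<open>G k k = 0\<close> by (simp add: H_def)
      qed
      ultimately show "k \<in> {k\<in>I. G k k \<noteq> 0} - {i}" using k by auto
    qed
    also have "\<dots> \<subset> {k\<in>I. G k k \<noteq> 0}" using i by blast
    finally have "card {k\<in>I. H k k \<noteq> 0} < card {k\<in>I. G k k \<noteq> 0}"
      using assms(1) by (intro psubset_card_mono) auto
    moreover have "psd_on I H"
      using psd_on_schur_complement[OF assms(1) less.prems i] unfolding H_def[abs_def] .
    ultimately obtain m :: nat and g where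
      g: "\<And>k l. k \<in> I \<Longrightarrow> l \<in> I \<Longrightarrow> H k l = (\<Sum>r<m. g r k * cnj (g r l))"
      using less.hyps by blast
    define \<rho> where "\<rho> = Re (G i i)"
    have \<rho>: "G i i = of_real \<rho>" "\<rho> > 0"
      using psd_on_diag[OF assms(1) less.prems i(1)] i(2)
      by (auto simp: \<rho>_def less_eq_complex_def complex_eq_iff)
    \<comment> \<open>The new vector is the pivot column over the square root of the pivot;
      Hermitian symmetry turns the conjugated column into the pivot row.\<close>
    define g' where "g' r = (if r = m then (\<lambda>k. G k i / of_real (sqrt \<rho>)) else g r)" for r
    have "G k l = (\<Sum>r<Suc m. g' r k * cnj (g' r l))" if kl: "k \<in> I" "l \<in> I" for k l
    proof -
      have "(\<Sum>r<m. g' r k * cnj (g' r l)) = H k l"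
        using g[OF kl] by (simp add: g'_def)
      moreover have "g' m k * cnj (g' m l) = G k i * G i l / G i i"
      proof -
        have "complex_of_real (sqrt \<rho>) * of_real (sqrt \<rho>) = of_real \<rho>"
          using \<rho>(2) by (simp flip: of_real_mult)
        then show ?thesis
          using \<rho>(1) psd_on_hermitian[OF assms(1) less.prems i(1) kl(2)] by (simp add: g'_def)
      qed
      ultimately show ?thesis by (simp add: H_def)
    qed
    then show ?thesis by blast
  qed
qed

section \<open>Kernels as a real vector space, and kernels representing positive functionals\<close>

instantiation "fun" :: (type, real_vector) real_vector
begin

definition scaleR_fun :: "real \<Rightarrow> ('a \<Rightarrow> 'b) \<Rightarrow> 'a \<Rightarrow> 'b" where
  "scaleR_fun c f = (\<lambda>x. c *\<^sub>R f x)"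

instance
  by standard (simp_all add: scaleR_fun_def plus_fun_def scaleR_add_right scaleR_add_left)

end

lemma sum_fun_apply: "(\<Sum>i\<in>A. h i) x = (\<Sum>i\<in>A. h i x)"
  by (induction A rule: infinite_finite_induct) auto

text \<open>A crude bound, from |v_i| |v_j| being at most the squared norm of \<open>v\<close>. It
  makes the identity an order unit: a large multiple of it dominates any given kernel.\<close>

lemma sesq_bound:
  assumes "finite I"
  shows "cmod (sesq I X v) \<le> (\<Sum>i\<in>I. \<Sum>j\<in>I. cmod (X i j)) * (\<Sum>k\<in>I. (cmod (v k))\<^sup>2)"
proof -
  define N where "N = (\<Sum>k\<in>I. (cmod (v k))\<^sup>2)"
  have le: "(cmod (v i))\<^sup>2 \<le> N" if "i \<in> I" for i
    unfolding N_def using assms that by (intro member_le_sum) auto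
  have "cmod (cnj (v i) * X i j * v j) \<le> cmod (X i j) * N" if "i \<in> I" "j \<in> I" for i j
  proof -
    have "0 \<le> (cmod (v i) - cmod (v j))\<^sup>2" by simp
    then have "cmod (v i) * cmod (v j) \<le> N"
      using le[OF that(1)] le[OF that(2)] by (simp add: power2_diff)
    then show ?thesis
      using mult_left_mono[of "cmod (v i) * cmod (v j)" N "cmod (X i j)"]
      by (simp add: norm_mult algebra_simps)
  qed
  then have "cmod (sesq I X v) \<le> (\<Sum>i\<in>I. \<Sum>j\<in>I. cmod (X i j) * N)"
    unfolding sesq_def by (intro order.trans[OF norm_sum] sum_mono) auto
  then show ?thesis by (simp add: N_def sum_distrib_right)
qed

lemma sesq_add: "sesq I (\<lambda>i j. X i j + Y i j) v = sesq I X v + sesq I Y v"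
  by (simp add: sesq_def algebra_simps sum.distrib)

lemma sesq_cmult: "sesq I (\<lambda>i j. c * X i j) v = c * sesq I X v"
  by (simp add: sesq_def sum_distrib_left mult_ac)

lemma sesq_adjoint: "sesq I (\<lambda>i j. cnj (X j i)) v = cnj (sesq I X v)"
  unfolding sesq_def by (subst sum.swap) (simp add: mult_ac)

lemma sesq_identity:
  assumes "finite I"
  shows "sesq I (\<lambda>i j. if i = j \<and> i \<in> I then 1 else 0) v = of_real (\<Sum>k\<in>I. (cmod (v k))\<^sup>2)"
proof -
  have "(\<Sum>j\<in>I. cnj (v i) * (if i = j \<and> i \<in> I then 1 else 0) * v j) = of_real ((cmod (v i))\<^sup>2)"
    if "i \<in> I" for i
  proof -
    have "(\<Sum>j\<in>I. cnj (v i) * (if i = j \<and> i \<in> I then 1 else 0) * v j)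
        = (\<Sum>j\<in>I. if i = j then cnj (v i) * v i else 0)"
      using that by (intro sum.cong) auto
    also have "\<dots> = v i * cnj (v i)" using assms that by simp
    finally show ?thesis by (simp only: complex_norm_square)
  qed
  then show ?thesis by (simp add: sesq_def)
qed

text \<open>Since the identity is an order unit in \<open>S\<close>, the real part of
  \<open>s\<close> extends to all kernels supported on \<open>I\<close>. The values of the extension
  on matrix units form \<open>G\<close>, and its positivity on rank one kernels makes
  \<open>G\<close> positive semidefinite.\<close>

lemma positive_functional_representation:
  fixes I :: "'a set" and S :: "('a \<Rightarrow> 'a \<Rightarrow> complex) set" and s :: "('a \<Rightarrow> 'a \<Rightarrow> complex) \<Rightarrow> complex"
  assumes fin: "finite I"
    and supp: "\<And>X i j. X \<in> S \<Longrightarrow> i \<notin> I \<or> j \<notin> I \<Longrightarrow> X i j = 0"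
    and S_add: "\<And>X Y. X \<in> S \<Longrightarrow> Y \<in> S \<Longrightarrow> (\<lambda>i j. X i j + Y i j) \<in> S"
    and S_mult: "\<And>c X. X \<in> S \<Longrightarrow> (\<lambda>i j. c * X i j) \<in> S"
    and S_adj: "\<And>X. X \<in> S \<Longrightarrow> (\<lambda>i j. cnj (X j i)) \<in> S"
    and S_id: "(\<lambda>i j. if i = j \<and> i \<in> I then 1 else 0) \<in> S"
    and s_add: "\<And>X Y. X \<in> S \<Longrightarrow> Y \<in> S \<Longrightarrow> s (\<lambda>i j. X i j + Y i j) = s X + s Y"
    and s_mult: "\<And>c X. X \<in> S \<Longrightarrow> s (\<lambda>i j. c * X i j) = c * s X"
    and s_pos: "\<And>X. X \<in> S \<Longrightarrow> psd_on I X \<Longrightarrow> 0 \<le> s X"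
  shows "\<exists>G. psd_on I G \<and> (\<forall>X\<in>S. s X = (\<Sum>i\<in>I. \<Sum>j\<in>I. X i j * G i j))"
proof -
  define One :: "'a \<Rightarrow> 'a \<Rightarrow> complex" where "One = (\<lambda>i j. if i = j \<and> i \<in> I then 1 else 0)"
  define ad :: "('a \<Rightarrow> 'a \<Rightarrow> complex) \<Rightarrow> 'a \<Rightarrow> 'a \<Rightarrow> complex" where "ad X = (\<lambda>i j. cnj (X j i))" for X
  \<comment> \<open>The cone of accretive matrices instead of the positive semidefinite ones makes it possible to
    extend over the whole matrix space rather than over its Hermitian part.\<close>
  define K where "K = {X. \<forall>v. 0 \<le> Re (sesq I X v)}"
  define mag where "mag X = (\<Sum>i\<in>I. \<Sum>j\<in>I. cmod (X i j))" for X :: "'a \<Rightarrow> 'a \<Rightarrow> complex"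
  have scaleR: "c *\<^sub>R X = (\<lambda>i j. of_real c * X i j)" for c and X :: "'a \<Rightarrow> 'a \<Rightarrow> complex"
    by (simp add: scaleR_fun_def fun_eq_iff scaleR_conv_of_real)
  have plus: "X + Y = (\<lambda>i j. X i j + Y i j)" for X Y :: "'a \<Rightarrow> 'a \<Rightarrow> complex"
    by (simp add: plus_fun_def)
  have One_S: "One \<in> S" using S_id by (simp add: One_def)
  have sesq_One: "sesq I One v = of_real (\<Sum>k\<in>I. (cmod (v k))\<^sup>2)" for v
    using sesq_identity[OF fin] by (simp add: One_def)
  have dominate: "0 \<le> Re (sesq I X v) + mag X * (\<Sum>k\<in>I. (cmod (v k))\<^sup>2)" for X v
    using sesq_bound[OF fin, of X v] abs_Re_le_cmod[of "sesq I X v"] by (simp add: mag_def)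
  \<comment> \<open>\<open>Y\<close> is the self-adjoint kernel iX + ad(iX). Adding a multiple of
    \<open>One\<close> makes it positive semidefinite, so \<open>s\<close> is real there; as
    \<open>s One\<close> is real too, i(s X - s (ad X)) is real.\<close>
  have s_Re: "Re (s (ad X)) = Re (s X)" if X: "X \<in> S" for X
  proof -
    define Y where "Y = (\<lambda>i j. \<i> * X i j + cnj (\<i> * X j i))"
    have adX: "ad X \<in> S" using S_adj X by (simp add: ad_def)
    have Y: "Y = (\<lambda>i j. \<i> * X i j + (-\<i>) * ad X i j)" by (simp add: Y_def ad_def fun_eq_iff)
    have Y_S: "Y \<in> S" unfolding Y by (intro S_add S_mult X adX)
    have s_Y: "s Y = \<i> * s X - \<i> * s (ad X)"
      unfolding Y s_add[OF S_mult[OF X] S_mult[OF adX]] s_mult[OF X] s_mult[OF adX] by simp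
    have "psd_on I (\<lambda>i j. Y i j + of_real (mag Y) * One i j)"
    proof -
      have "Im (sesq I Y v) = 0" for v
        using sesq_add[of I "\<lambda>i j. \<i> * X i j" "\<lambda>i j. cnj (\<i> * X j i)" v]
          sesq_adjoint[of I "\<lambda>i j. \<i> * X i j" v] by (simp add: Y_def)
      then show ?thesis using dominate[of Y]
        by (simp add: psd_on_def sesq_add sesq_cmult sesq_One less_eq_complex_def)
    qed
    then have "0 \<le> s (\<lambda>i j. Y i j + of_real (mag Y) * One i j)"
      by (intro s_pos S_add S_mult Y_S One_S)
    then have "0 \<le> s Y + of_real (mag Y) * s One"
      by (simp add: s_add s_mult S_mult Y_S One_S)
    moreover have "0 \<le> s One"
      by (rule s_pos[OF One_S]) (simp add: psd_on_def sesq_One less_eq_complex_def sum_nonneg)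
    ultimately show ?thesis by (simp add: s_Y less_eq_complex_def)
  qed
  \<comment> \<open>For accretive \<open>X\<close>, the kernel \<open>X + ad X\<close> is positive
    semidefinite, and by \<open>s_Re\<close> its value under \<open>s\<close> has real part 2 Re (s
    X).\<close>
  have s_K: "0 \<le> Re (s X)" if "X \<in> S" "X \<in> K" for X
  proof -
    have adX: "ad X \<in> S" using S_adj that by (simp add: ad_def)
    have "psd_on I (\<lambda>i j. X i j + ad X i j)"
      using that(2) by (simp add: psd_on_def sesq_add ad_def sesq_adjoint K_def less_eq_complex_def)
    then have "0 \<le> s X + s (ad X)"
      using s_pos[OF S_add[OF that(1) adX]] s_add[OF that(1) adX] by simp
    then show ?thesis using s_Re[OF that(1)] by (simp add: less_eq_complex_def)
  qed
  have zero_S: "(0::'a \<Rightarrow> 'a \<Rightarrow> complex) \<in> S"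
    using S_mult[OF One_S, of 0] by (simp add: zero_fun_def)
  have f: "positive_functional_on K S (\<lambda>X. Re (s X))"
    unfolding positive_functional_on_def
    by (auto simp: subspace_def zero_S plus scaleR S_add S_mult s_add s_mult s_K)
  \<comment> \<open>Matrix units and their multiples by i: together they span, over the reals, all
    kernels supported on \<open>I\<close>.\<close>
  define E where "E c i j = (\<lambda>k l. if k = i \<and> l = j then c else 0)" for c :: complex and i j :: 'a
  define B where "B = (\<lambda>(i, j). E 1 i j) ` (I \<times> I) \<union> (\<lambda>(i, j). E \<i> i j) ` (I \<times> I)"
  have K_add: "X + Y \<in> K" if "X \<in> K" "Y \<in> K" for X Y
    using that by (simp add: K_def plus sesq_add)
  have K_scale: "c *\<^sub>R X \<in> K" if "0 \<le> c" "X \<in> K" for c X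
    using that by (simp add: K_def scaleR sesq_cmult)
  have upper: "\<exists>Y\<in>S. Y - X \<in> K" for X
  proof
    show "(\<lambda>i j. of_real (mag X) * One i j) \<in> S" using S_mult One_S .
    have eq: "(\<lambda>i j. of_real (mag X) * One i j) - X = (\<lambda>i j. of_real (mag X) * One i j + (-1) * X i j)"
      by (simp add: fun_eq_iff)
    have mag: "mag (\<lambda>i j. (-1) * X i j) = mag X" by (simp add: mag_def)
    have "0 \<le> Re ((-1) * sesq I X v) + mag X * (\<Sum>k\<in>I. (cmod (v k))\<^sup>2)" for v
      using dominate[of "\<lambda>i j. (-1) * X i j" v] unfolding mag sesq_cmult .
    then show "(\<lambda>i j. of_real (mag X) * One i j) - X \<in> K"
      unfolding eq K_def mem_Collect_eq sesq_add sesq_cmult sesq_One by simp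
  qed
  have lower: "\<exists>Y\<in>S. X - Y \<in> K" for X
  proof -
    obtain Y where Y: "Y \<in> S" "Y - (-X) \<in> K" using upper by blast
    have "(-1) *\<^sub>R Y \<in> S" using S_mult[OF Y(1)] unfolding scaleR .
    moreover have "X - (-1) *\<^sub>R Y \<in> K" using Y(2) by (simp only: scaleR_minus1_left diff_minus_eq_add add.commute)
    ultimately show ?thesis by blast
  qed
  have "finite B" unfolding B_def using fin by auto
  then obtain f' where f': "positive_functional_on K (span (B \<union> S)) f'" "\<forall>X\<in>S. f' X = Re (s X)"
    using positive_functional_extend_finite[OF _ f K_add K_scale lower upper] by blast
  define W where "W = span (B \<union> S)"
  have W: "subspace W" by (simp add: W_def subspace_span)
  have E_W: "E 1 i j \<in> W" "E \<i> i j \<in> W" if "i \<in> I" "j \<in> I" for i j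
    using that by (auto simp: W_def B_def intro!: span_base)
  have f'_add: "f' (X + Y) = f' X + f' Y" if "X \<in> W" "Y \<in> W" for X Y
    using f'(1) that by (simp add: positive_functional_on_def W_def)
  have f'_scale: "f' (c *\<^sub>R X) = c * f' X" if "X \<in> W" for c X
    using f'(1) that by (simp add: positive_functional_on_def W_def)
  have f'_zero: "f' 0 = 0" using f'_scale[OF subspace_0[OF W], of 0] by simp
  have f'_sum: "f' (\<Sum>a\<in>A. h a) = (\<Sum>a\<in>A. f' (h a))" if "\<And>a. a \<in> A \<Longrightarrow> h a \<in> W"
    for A :: "'a set" and h
    using that
    by (induction A rule: infinite_finite_induct) (auto simp: f'_zero f'_add subspace_sum[OF W])
  \<comment> \<open>A complex linear functional with real part u takes the value u(E) - i u(iE) at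
    E. With this choice \<open>f'\<close> at c times a matrix unit is the real part of c times the
    entry of \<open>G\<close>.\<close>
  define G where "G i j = Complex (f' (E 1 i j)) (- f' (E \<i> i j))" for i j
  have supported: "X \<in> W \<and> f' X = Re (\<Sum>i\<in>I. \<Sum>j\<in>I. X i j * G i j)"
    if X: "\<And>i j. i \<notin> I \<or> j \<notin> I \<Longrightarrow> X i j = 0" for X
  proof -
    define T where "T i j = Re (X i j) *\<^sub>R E 1 i j + Im (X i j) *\<^sub>R E \<i> i j" for i j
    have "X k l = (\<Sum>i\<in>I. \<Sum>j\<in>I. T i j) k l" for k l
    proof -
      have "T i j k l = (if j = l then if i = k then X k l else 0 else 0)" for i j
        by (simp add: T_def E_def scaleR_fun_def complex_eq_iff)
      then have "(\<Sum>i\<in>I. \<Sum>j\<in>I. T i j) k l = (\<Sum>i\<in>I. \<Sum>j\<in>I. if j = l then if i = k then X k l else 0 else 0)"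
        by (simp add: sum_fun_apply)
      also have "\<dots> = X k l"
        using X[of k l] fin by (cases "l \<in> I"; cases "k \<in> I") (auto simp: sum.delta sum.delta')
      finally show ?thesis by simp
    qed
    then have X_eq: "X = (\<Sum>i\<in>I. \<Sum>j\<in>I. T i j)" by (intro ext)
    have T_W: "T i j \<in> W" if "i \<in> I" "j \<in> I" for i j
      unfolding T_def using W E_W[OF that] by (intro subspace_add subspace_scale)
    have "f' X = (\<Sum>i\<in>I. \<Sum>j\<in>I. f' (T i j))"
      unfolding X_eq by (simp add: f'_sum T_W subspace_sum[OF W])
    also have "\<dots> = (\<Sum>i\<in>I. \<Sum>j\<in>I. Re (X i j * G i j))"
      by (intro sum.cong refl) (simp add: T_def f'_add f'_scale E_W subspace_scale[OF W] G_def)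
    finally have "f' X = Re (\<Sum>i\<in>I. \<Sum>j\<in>I. X i j * G i j)" by simp
    moreover have "X \<in> W" by (subst X_eq) (intro subspace_sum[OF W] T_W)
    ultimately show ?thesis by blast
  qed
  have "psd_on I G"
    unfolding psd_on_def
  proof
    fix v
    \<comment> \<open>The form of this rank one kernel is a squared modulus, so c times it is
      accretive whenever Re c is nonnegative, and pairing it with \<open>G\<close> gives
      \<open>c * sesq I G v\<close>. The choices 1, i and -i of c then show that
      \<open>sesq I G v\<close> is real and nonnegative.\<close>
    define X where "X i j = (if i \<in> I \<and> j \<in> I then cnj (v i) * v j else 0)" for i j
    have eq: "(\<Sum>i\<in>I. \<Sum>j\<in>I. (c * X i j) * G i j) = c * sesq I G v" for c
      by (simp add: X_def sesq_def mult_ac sum_distrib_left)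
    have sesq_X: "sesq I X w = of_real ((cmod (\<Sum>j\<in>I. v j * w j))\<^sup>2)" for w
      unfolding complex_norm_square
      by (simp add: sesq_def X_def sum_product mult_ac) (subst sum.swap, simp add: mult_ac)
    have *: "0 \<le> Re (c * sesq I G v)" if "0 \<le> Re c" for c
    proof -
      have "(\<lambda>i j. c * X i j) \<in> K" using that by (simp add: K_def sesq_cmult sesq_X)
      moreover have "(\<lambda>i j. c * X i j) \<in> W \<and>
        f' (\<lambda>i j. c * X i j) = Re (\<Sum>i\<in>I. \<Sum>j\<in>I. (c * X i j) * G i j)"
        by (rule supported) (auto simp: X_def)
      ultimately show ?thesis
        using f'(1) unfolding eq positive_functional_on_def W_def by (metis IntI)
    qed
    show "0 \<le> sesq I G v"
      using *[of 1] *[of \<i>] *[of "-\<i>"] by (auto simp: less_eq_complex_def)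
  qed
  moreover have "s X = (\<Sum>i\<in>I. \<Sum>j\<in>I. X i j * G i j)" if X: "X \<in> S" for X
  proof -
    \<comment> \<open>The extension only remembers real parts; multiplying by 1 and by i recovers
      the complex value.\<close>
    have *: "Re (c * s X) = Re (c * (\<Sum>i\<in>I. \<Sum>j\<in>I. X i j * G i j))" for c
    proof -
      have "(\<lambda>i j. c * X i j) \<in> W \<and>
        f' (\<lambda>i j. c * X i j) = Re (\<Sum>i\<in>I. \<Sum>j\<in>I. (c * X i j) * G i j)"
        by (rule supported) (auto simp: supp[OF X])
      then have "Re (s (\<lambda>i j. c * X i j)) = Re (\<Sum>i\<in>I. \<Sum>j\<in>I. (c * X i j) * G i j)"
        using f'(2) S_mult[OF X, of c] by (simp del: Re_sum)
      then show ?thesis unfolding s_mult[OF X] sum_distrib_left by (simp only: mult.assoc)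
    qed
    show ?thesis using *[of 1] *[of \<i>] by (simp add: complex_eq_iff)
  qed
  ultimately show ?thesis by blast
qed

section \<open>Toeplitz matrices and polynomial densities\<close>

lemma block_index_less:
  fixes p a :: nat
  assumes "p < k" "a < m" shows "p * m + a < k * m"
proof -
  have "p * m + a < Suc p * m" using assms by simp
  also have "\<dots> \<le> k * m" using assms by (intro mult_le_mono1) auto
  finally show ?thesis .
qed

lemma sum_lessThan_mult:
  fixes f :: "nat \<Rightarrow> 'b::comm_monoid_add"
  shows "(\<Sum>i<k * m. f i) = (\<Sum>(p, a)\<in>{..<k} \<times> {..<m}. f (p * m + a))"
proof (cases "m = 0")
  case False
  from False show ?thesis
    by (intro sum.reindex_bij_witness[where i = "\<lambda>(p, a). p * m + a" and j = "\<lambda>i. (i div m, i mod m)"])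
      (auto simp: less_mult_imp_div_less block_index_less)
qed simp

definition block_fun :: "nat \<Rightarrow> nat \<Rightarrow> (nat \<Rightarrow> nat \<Rightarrow> complex mat) \<Rightarrow> nat \<times> nat \<Rightarrow> nat \<times> nat \<Rightarrow> complex" where
  "block_fun k m X = (\<lambda>(p, a) (q, b). X p q $$ (a, b))"

lemma block_mat_form:
  assumes "v \<in> carrier_vec (k * m)"
  shows "(block_mat k m X *\<^sub>v v) \<bullet>c v =
    sesq ({..<k} \<times> {..<m}) (block_fun k m X) (\<lambda>(p, a). v $ (p * m + a))"
proof -
  have *: "block_mat k m X $$ (p * m + a, q * m + b) = X p q $$ (a, b)"
    if "p < k" "q < k" "a < m" "b < m" for p q a b
    using block_index_less[OF that(1,3)] block_index_less[OF that(2,4)] that by (simp add: block_mat_def)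
  have "(block_mat k m X *\<^sub>v v) \<bullet>c v =
      (\<Sum>i<k * m. \<Sum>j<k * m. cnj (v $ i) * block_mat k m X $$ (i, j) * v $ j)"
    using assms
    by (simp add: scalar_prod_def mult_mat_vec_def row_def block_mat_def atLeast0LessThan
        sum_distrib_right sum_distrib_left mult_ac)
  also have "\<dots> = sesq ({..<k} \<times> {..<m}) (block_fun k m X) (\<lambda>(p, a). v $ (p * m + a))"
    unfolding sesq_def sum_lessThan_mult
    by (intro sum.cong refl) (auto simp: * block_fun_def intro!: sum.cong)
  finally show ?thesis .
qed

lemma sesq_cong:
  assumes "\<And>i. i \<in> I \<Longrightarrow> v i = w i" "\<And>i j. i \<in> I \<Longrightarrow> j \<in> I \<Longrightarrow> G i j = H i j"
  shows "sesq I G v = sesq I H w"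
  unfolding sesq_def by (intro sum.cong refl) (simp add: assms)

lemma psd_block_mat_iff:
  "psd_mat (k * m) (block_mat k m X) \<longleftrightarrow> psd_on ({..<k} \<times> {..<m}) (block_fun k m X)"
proof
  assume psd: "psd_mat (k * m) (block_mat k m X)"
  show "psd_on ({..<k} \<times> {..<m}) (block_fun k m X)"
    unfolding psd_on_def
  proof
    fix w :: "nat \<times> nat \<Rightarrow> complex"
    define v where "v = vec (k * m) (\<lambda>i. w (i div m, i mod m))"
    have v: "v \<in> carrier_vec (k * m)" by (simp add: v_def)
    have "v $ (p * m + a) = w (p, a)" if "p < k" "a < m" for p a
      using block_index_less[OF that] that by (simp add: v_def)
    then have "sesq ({..<k} \<times> {..<m}) (block_fun k m X) w = (block_mat k m X *\<^sub>v v) \<bullet>c v"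
      unfolding block_mat_form[OF v] by (intro sesq_cong) auto
    then show "0 \<le> sesq ({..<k} \<times> {..<m}) (block_fun k m X) w"
      using psd v by (simp add: psd_mat_def)
  qed
next
  assume "psd_on ({..<k} \<times> {..<m}) (block_fun k m X)"
  then show "psd_mat (k * m) (block_mat k m X)"
    by (auto simp: psd_mat_def psd_on_def block_mat_form) (simp add: block_mat_def)
qed

section \<open>Toeplitz matrices and powers of the shift\<close>

lemma toeplitzI:
  assumes "A \<in> carrier_mat d d" "\<And>i j. i < d \<Longrightarrow> j < d \<Longrightarrow> A $$ (i, j) = a (int i - int j)"
  shows "A \<in> toeplitz d"
proof -
  have "A = mat d d (\<lambda>(i, j). a (int i - int j))" using assms by (intro eq_matI) auto
  then show ?thesis by (auto simp: toeplitz_def)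
qed

lemma toeplitzE:
  assumes "A \<in> toeplitz d"
  obtains a where "A = mat d d (\<lambda>(i, j). a (int i - int j))"
  using assms by (auto simp: toeplitz_def)

lemma toeplitz_carrier: "A \<in> toeplitz d \<Longrightarrow> A \<in> carrier_mat d d"
  by (auto simp: toeplitz_def)

lemma toeplitz_one: "1\<^sub>m d \<in> toeplitz d"
  by (rule toeplitzI[where a = "\<lambda>m. if m = 0 then 1 else 0"]) auto

lemma shift_mat_pow: "shift_mat d ^\<^sub>m k = mat d d (\<lambda>(i, j). if j = i + k then 1 else 0)"
proof (induction k)
  case 0
  show ?case by (auto simp: shift_mat_def)
next
  case (Suc k)
  show ?case
  proof (rule eq_matI)
    fix i j assume ij: "i < dim_row (mat d d (\<lambda>(i, j). if j = i + Suc k then 1 else 0))"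
      "j < dim_col (mat d d (\<lambda>(i, j). if j = i + Suc k then 1 else 0))"
    then have "(shift_mat d ^\<^sub>m Suc k) $$ (i, j) =
        (\<Sum>l<d. if l = i + k then (if j = l + 1 then 1 else 0) else 0)"
      unfolding pow_mat.simps Suc
      by (simp add: times_mat_def scalar_prod_def row_def col_def shift_mat_def atLeast0LessThan
          if_distrib[of "\<lambda>x. x * _"] cong: if_cong)
    also have "\<dots> = (if j = i + Suc k then 1 else 0)" using ij by (auto simp: sum.delta)
    finally show "(shift_mat d ^\<^sub>m Suc k) $$ (i, j) =
        mat d d (\<lambda>(i, j). if j = i + Suc k then 1 else 0) $$ (i, j)" using ij by simp
  qed (simp_all add: shift_mat_def)
qed

lemma mat_adjoint_index:
  assumes "i < dim_col A" "j < dim_row A"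
  shows "mat_adjoint A $$ (i, j) = conjugate (A $$ (j, i))"
  using assms by (simp add: mat_adjoint_def mat_of_rows_index)

lemma mat_adjoint_shift_pow:
  "mat_adjoint (shift_mat d) ^\<^sub>m k = mat d d (\<lambda>(i, j). if i = j + k then 1 else 0)"
proof (induction k)
  case 0
  show ?case by (auto simp: shift_mat_def mat_adjoint_def)
next
  case (Suc k)
  have adj: "mat_adjoint (shift_mat d) = mat d d (\<lambda>(i, j). if i = j + 1 then 1 else 0)"
  proof (rule eq_matI)
    fix i j assume "i < dim_row (mat d d (\<lambda>(i, j). if i = j + 1 then 1 else 0))"
      "j < dim_col (mat d d (\<lambda>(i, j). if i = j + 1 then 1 else 0))"
    then show "mat_adjoint (shift_mat d) $$ (i, j) = mat d d (\<lambda>(i, j). if i = j + 1 then 1 else 0) $$ (i, j)"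
      using mat_adjoint_index[of i "shift_mat d" j] by (simp add: shift_mat_def)
  qed (simp_all add: shift_mat_def mat_adjoint_def)
  show ?case
  proof (rule eq_matI)
    fix i j assume ij: "i < dim_row (mat d d (\<lambda>(i, j). if i = j + Suc k then 1 else 0))"
      "j < dim_col (mat d d (\<lambda>(i, j). if i = j + Suc k then 1 else 0))"
    then have "(mat_adjoint (shift_mat d) ^\<^sub>m Suc k) $$ (i, j) =
        (\<Sum>l<d. if l = j + 1 then (if i = l + k then 1 else 0) else 0)"
      unfolding pow_mat.simps Suc unfolding adj
      by (simp add: times_mat_def scalar_prod_def row_def col_def atLeast0LessThan
          if_distrib[of "\<lambda>x. _ * x"] cong: if_cong)
    also have "\<dots> = (if i = j + Suc k then 1 else 0)" using ij by (auto simp: sum.delta)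
    finally show "(mat_adjoint (shift_mat d) ^\<^sub>m Suc k) $$ (i, j) =
        mat d d (\<lambda>(i, j). if i = j + Suc k then 1 else 0) $$ (i, j)" using ij by simp
  qed (simp_all add: adj)
qed

lemma shift_mat_pow_toeplitz: "shift_mat d ^\<^sub>m k \<in> toeplitz d"
  by (rule toeplitzI[where a = "\<lambda>m. if m = - int k then 1 else 0"]) (auto simp: shift_mat_pow)

lemma mat_adjoint_shift_pow_toeplitz: "mat_adjoint (shift_mat d) ^\<^sub>m k \<in> toeplitz d"
  by (rule toeplitzI[where a = "\<lambda>m. if m = int k then 1 else 0"]) (auto simp: mat_adjoint_shift_pow)

text \<open>The density is formally \<open>\<phi>\<close> applied to the Toeplitz matrix with
  entries z^(b-a), which collects the identity and the weighted powers of the shift and its adjoint.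
  A pairing with \<open>M\<close> therefore becomes a pairing of \<open>M\<close> with these
  powers.\<close>

lemma poly_density_entry:
  assumes "p < n" "q < n"
    and \<phi>: "\<And>A. A \<in> toeplitz d \<Longrightarrow> \<phi> A $$ (p, q) = (\<Sum>a<d. \<Sum>b<d. M a b * A $$ (a, b))"
  shows "poly_density d n \<phi> z $$ (p, q) = (\<Sum>a<d. \<Sum>b<d. M a b * z powi (int b - int a))"
proof -
  \<comment> \<open>The entries of that matrix as they arise from the three parts of
    \<open>poly_density\<close>; for each pair of indices at most one term survives.\<close>
  define R where "R a b = (if a = b then 1 else 0) + (\<Sum>k = 1..d - 1. (if b = a + k then 1 else 0) * z ^ k)
      + (\<Sum>k = 1..d - 1. (if a = b + k then 1 else 0) * z powi (- int k))" for a b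
  have R: "R a b = z powi (int b - int a)" if "a < d" "b < d" for a b
  proof -
    have up: "(\<Sum>k = 1..d - 1. (if b = a + k then 1 else 0) * z ^ k) = (if a < b then z ^ (b - a) else 0)"
    proof -
      have "(\<Sum>k = 1..d - 1. (if b = a + k then 1 else 0) * z ^ k)
          = (\<Sum>k = 1..d - 1. if k = b - a then (if a < b then z ^ k else 0) else 0)"
        by (intro sum.cong) auto
      then show ?thesis using that by (auto simp: Suc_le_eq)
    qed
    have down: "(\<Sum>k = 1..d - 1. (if a = b + k then 1 else 0) * z powi (- int k))
        = (if b < a then z powi (int b - int a) else 0)"
    proof -
      have "(\<Sum>k = 1..d - 1. (if a = b + k then 1 else 0) * z powi (- int k))
          = (\<Sum>k = 1..d - 1. if k = a - b then (if b < a then z powi (int b - int a) else 0) else 0)"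
        by (intro sum.cong) auto
      then show ?thesis using that by (auto simp: Suc_le_eq)
    qed
    show ?thesis unfolding R_def up down
      by (auto simp: power_int_def nat_diff_distrib)
  qed
  have "poly_density d n \<phi> z $$ (p, q) = (\<Sum>a<d. \<Sum>b<d. M a b * R a b)"
  proof -
    have 1: "\<phi> (1\<^sub>m d) $$ (p, q) = (\<Sum>a<d. \<Sum>b<d. M a b * (if a = b then 1 else 0))"
      unfolding \<phi>[OF toeplitz_one] by (intro sum.cong) auto
    have 2: "\<phi> (shift_mat d ^\<^sub>m k) $$ (p, q) = (\<Sum>a<d. \<Sum>b<d. M a b * (if b = a + k then 1 else 0))" for k
      unfolding \<phi>[OF shift_mat_pow_toeplitz] unfolding shift_mat_pow by (intro sum.cong) auto
    have 3: "\<phi> (mat_adjoint (shift_mat d) ^\<^sub>m k) $$ (p, q)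
        = (\<Sum>a<d. \<Sum>b<d. M a b * (if a = b + k then 1 else 0))" for k
      unfolding \<phi>[OF mat_adjoint_shift_pow_toeplitz] unfolding mat_adjoint_shift_pow
      by (intro sum.cong) auto
    have swap: "(\<Sum>k = 1..d - 1. (\<Sum>a<d. \<Sum>b<d. M a b * c a b k) * h k)
        = (\<Sum>a<d. \<Sum>b<d. M a b * (\<Sum>k = 1..d - 1. c a b k * h k))" for c :: "nat \<Rightarrow> nat \<Rightarrow> nat \<Rightarrow> complex" and h
    proof -
      have "(\<Sum>k = 1..d - 1. (\<Sum>a<d. \<Sum>b<d. M a b * c a b k) * h k)
          = (\<Sum>k = 1..d - 1. \<Sum>a<d. \<Sum>b<d. M a b * (c a b k * h k))"
        by (simp add: sum_distrib_right mult.assoc)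
      also have "\<dots> = (\<Sum>a<d. \<Sum>k = 1..d - 1. \<Sum>b<d. M a b * (c a b k * h k))"
        by (rule sum.swap)
      also have "\<dots> = (\<Sum>a<d. \<Sum>b<d. \<Sum>k = 1..d - 1. M a b * (c a b k * h k))"
        by (intro sum.cong refl sum.swap)
      finally show ?thesis by (simp add: sum_distrib_left)
    qed
    show ?thesis using assms(1,2)
      unfolding poly_density_def R_def distrib_left sum.distrib
      by (simp only: index_mat split_conv 1 2 3 swap)
  qed
  then show ?thesis using R by simp
qed

text \<open>Entry (p, q) of V^* A V, where column p of V holds the first \<open>d\<close>
  coefficients of \<open>Q p\<close>.\<close>

definition row_form :: "nat \<Rightarrow> (nat \<Rightarrow> complex poly) \<Rightarrow> complex mat \<Rightarrow> nat \<Rightarrow> nat \<Rightarrow> complex" where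
  "row_form d Q A p q = (\<Sum>a<d. \<Sum>b<d. cnj (coeff (Q p) a) * A $$ (a, b) * coeff (Q q) b)"

lemma poly_eq_sum_lessThan:
  assumes "degree (q :: complex poly) < d"
  shows "poly q z = (\<Sum>a<d. coeff q a * z ^ a)"
proof -
  have "(\<Sum>a<d. coeff q a * z ^ a) = (\<Sum>a\<le>degree q. coeff q a * z ^ a)"
    using assms by (intro sum.mono_neutral_right) (auto simp: coeff_eq_0)
  then show ?thesis by (simp add: poly_altdef)
qed

lemma power_int_diff_unimodular:
  assumes "cmod z = 1" shows "z powi (int b - int a) = cnj (z ^ a) * z ^ b"
proof -
  have nz: "z \<noteq> 0" using assms by auto
  have "z * cnj z = 1" using complex_norm_square[of z] assms by simp
  then have "z ^ a * cnj (z ^ a) = 1" by (simp flip: power_mult_distrib)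
  then have "inverse (z ^ a) = cnj (z ^ a)" by (rule inverse_unique)
  then show ?thesis using nz by (simp add: power_int_diff divide_inverse mult.commute)
qed

text \<open>On the circle z^(b-a) is the product of the conjugate of z^a with z^b, so each double
  sum over coefficients factors into a conjugated value of one polynomial times a value of the
  other.\<close>

lemma poly_density_row_forms:
  fixes m :: nat
  assumes "p < n" "q < n" "cmod z = 1"
    and deg: "\<And>l. l < m \<Longrightarrow> degree (Q l p) < d" "\<And>l. l < m \<Longrightarrow> degree (Q l q) < d"
    and \<phi>: "\<And>A. A \<in> toeplitz d \<Longrightarrow> \<phi> A $$ (p, q) = (\<Sum>l<m. row_form d (Q l) A p q)"
  shows "poly_density d n \<phi> z $$ (p, q) = (\<Sum>l<m. cnj (poly (Q l p) z) * poly (Q l q) z)"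
proof -
  have swap: "(\<Sum>l<m. \<Sum>a<d. \<Sum>b<d. F l a b) = (\<Sum>a<d. \<Sum>b<d. \<Sum>l<m. F l a b)"
    for F :: "nat \<Rightarrow> nat \<Rightarrow> nat \<Rightarrow> complex"
    by (subst sum.swap) (intro sum.cong refl sum.swap)
  have "\<phi> A $$ (p, q) = (\<Sum>a<d. \<Sum>b<d. (\<Sum>l<m. cnj (coeff (Q l p) a) * coeff (Q l q) b) * A $$ (a, b))"
    if "A \<in> toeplitz d" for A
    unfolding \<phi>[OF that] row_form_def swap by (simp add: sum_distrib_right sum_distrib_left mult_ac)
  from poly_density_entry[OF assms(1,2) this, of z]
  have "poly_density d n \<phi> z $$ (p, q) = (\<Sum>a<d. \<Sum>b<d. \<Sum>l<m.
      cnj (coeff (Q l p) a * z ^ a) * (coeff (Q l q) b * z ^ b))"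
    by (simp add: power_int_diff_unimodular[OF assms(3)] sum_distrib_right sum_distrib_left mult_ac)
  also have "\<dots> = (\<Sum>l<m. cnj (poly (Q l p) z) * poly (Q l q) z)"
    unfolding swap[symmetric] using deg
    by (intro sum.cong refl) (simp add: poly_eq_sum_lessThan[where d = d] sum_product)
  finally show ?thesis .
qed

section \<open>Completely positive maps on Toeplitz matrices\<close>

lemma toeplitz_add: "A \<in> toeplitz d \<Longrightarrow> B \<in> toeplitz d \<Longrightarrow> A + B \<in> toeplitz d"
  by (elim toeplitzE, rule toeplitzI[where a = "\<lambda>m. _ m + _ m"]) auto

lemma toeplitz_smult: "A \<in> toeplitz d \<Longrightarrow> c \<cdot>\<^sub>m A \<in> toeplitz d"
  by (elim toeplitzE, rule toeplitzI[where a = "\<lambda>m. c * _ m"]) auto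

lemma toeplitz_adjoint: "A \<in> toeplitz d \<Longrightarrow> mat d d (\<lambda>(i, j). cnj (A $$ (j, i))) \<in> toeplitz d"
  by (elim toeplitzE, rule toeplitzI[where a = "\<lambda>m. cnj (_ (- m))"]) auto

lemma toeplitz_zero: "0\<^sub>m d d \<in> toeplitz d"
  by (rule toeplitzI[where a = "\<lambda>_. 0"]) auto

lemma toeplitz_linearD:
  assumes "toeplitz_linear d n \<phi>"
  shows "A \<in> toeplitz d \<Longrightarrow> \<phi> A \<in> carrier_mat n n"
    and "A \<in> toeplitz d \<Longrightarrow> B \<in> toeplitz d \<Longrightarrow> \<phi> (A + B) = \<phi> A + \<phi> B"
    and "A \<in> toeplitz d \<Longrightarrow> \<phi> (c \<cdot>\<^sub>m A) = c \<cdot>\<^sub>m \<phi> A"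
    and "\<phi> (0\<^sub>m d d) = 0\<^sub>m n n"
proof -
  show *: "A \<in> toeplitz d \<Longrightarrow> \<phi> A \<in> carrier_mat n n"
    "A \<in> toeplitz d \<Longrightarrow> \<phi> (c \<cdot>\<^sub>m A) = c \<cdot>\<^sub>m \<phi> A" for A c
    using assms by (auto simp: toeplitz_linear_def)
  show "A \<in> toeplitz d \<Longrightarrow> B \<in> toeplitz d \<Longrightarrow> \<phi> (A + B) = \<phi> A + \<phi> B"
    using assms by (auto simp: toeplitz_linear_def)
  have "\<phi> (0 \<cdot>\<^sub>m 0\<^sub>m d d) = 0 \<cdot>\<^sub>m \<phi> (0\<^sub>m d d)" by (rule *(2)[OF toeplitz_zero])
  also have "\<dots> = 0\<^sub>m n n" using *(1)[OF toeplitz_zero] by (intro eq_matI) auto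
  also have "0 \<cdot>\<^sub>m 0\<^sub>m d d = (0\<^sub>m d d :: complex mat)" by (intro eq_matI) auto
  finally show "\<phi> (0\<^sub>m d d) = 0\<^sub>m n n" .
qed

definition row_map :: "nat \<Rightarrow> nat \<Rightarrow> (nat \<Rightarrow> complex poly) \<Rightarrow> complex mat \<Rightarrow> complex mat" where
  "row_map d n Q A = mat n n (\<lambda>(p, q). row_form d Q A p q)"

lemma row_form_add:
  assumes "A \<in> carrier_mat d d" "B \<in> carrier_mat d d"
  shows "row_form d Q (A + B) p q = row_form d Q A p q + row_form d Q B p q"
  unfolding row_form_def sum.distrib[symmetric]
  using assms by (intro sum.cong refl) (auto simp: algebra_simps)

lemma row_form_smult:
  assumes "A \<in> carrier_mat d d"
  shows "row_form d Q (c \<cdot>\<^sub>m A) p q = c * row_form d Q A p q"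
  unfolding row_form_def sum_distrib_left
  using assms by (intro sum.cong refl) auto

lemma toeplitz_linear_row_map: "toeplitz_linear d n (row_map d n Q)"
  unfolding toeplitz_linear_def
  by (auto simp: row_map_def row_form_add row_form_smult toeplitz_carrier intro!: eq_matI)

lemma toeplitz_linear_diff:
  assumes "toeplitz_linear d n \<phi>" "toeplitz_linear d n \<psi>"
  shows "toeplitz_linear d n (\<lambda>A. \<phi> A - \<psi> A)"
  unfolding toeplitz_linear_def
proof (intro conjI ballI allI)
  fix A B c assume A: "A \<in> toeplitz d" and B: "B \<in> toeplitz d"
  note c = toeplitz_linearD(1)[OF assms(1)] toeplitz_linearD(1)[OF assms(2)]
  show "\<phi> A - \<psi> A \<in> carrier_mat n n" using c[OF A] by (auto simp: minus_carrier_mat)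
  show "\<phi> (A + B) - \<psi> (A + B) = \<phi> A - \<psi> A + (\<phi> B - \<psi> B)"
    using c[OF A] c[OF B] unfolding toeplitz_linearD(2)[OF assms(1) A B] toeplitz_linearD(2)[OF assms(2) A B]
    by (intro eq_matI) auto
  show "\<phi> (c \<cdot>\<^sub>m A) - \<psi> (c \<cdot>\<^sub>m A) = c \<cdot>\<^sub>m (\<phi> A - \<psi> A)"
    using c[OF A] unfolding toeplitz_linearD(3)[OF assms(1) A] toeplitz_linearD(3)[OF assms(2) A]
    by (intro eq_matI) (auto simp: algebra_simps)
qed

section \<open>Completely positive maps as sums of compressions\<close>

lemma sum_reorder:
  fixes T :: "'p \<Rightarrow> 'r \<Rightarrow> 'p \<Rightarrow> 'r \<Rightarrow> 'l \<Rightarrow> 'a \<Rightarrow> 'a \<Rightarrow> 'c::comm_monoid_add"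
  shows "(\<Sum>p\<in>P. \<Sum>r\<in>R. \<Sum>q\<in>P. \<Sum>s\<in>R. \<Sum>l\<in>L. \<Sum>a\<in>A. \<Sum>b\<in>A. T p r q s l a b) =
    (\<Sum>l\<in>L. \<Sum>p\<in>P. \<Sum>a\<in>A. \<Sum>q\<in>P. \<Sum>b\<in>A. \<Sum>r\<in>R. \<Sum>s\<in>R. T p r q s l a b)"
proof -
  have "(\<Sum>(p, r, q, s, l, a, b)\<in>P \<times> R \<times> P \<times> R \<times> L \<times> A \<times> A. T p r q s l a b) =
    (\<Sum>(l, p, a, q, b, r, s)\<in>L \<times> P \<times> A \<times> P \<times> A \<times> R \<times> R. T p r q s l a b)"
    by (rule sum.reindex_bij_witness[where i = "\<lambda>(l, p, a, q, b, r, s). (p, r, q, s, l, a, b)"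
          and j = "\<lambda>(p, r, q, s, l, a, b). (l, p, a, q, b, r, s)"]) auto
  then show ?thesis by (simp add: sum.cartesian_product')
qed

lemma cnj_sum_mult_sum:
  "cnj (\<Sum>r\<in>R. f r) * x * (\<Sum>s\<in>T. h s) = (\<Sum>r\<in>R. \<Sum>s\<in>T. cnj (f r) * x * h s)"
  by (simp flip: sum_distrib_left sum_distrib_right)

text \<open>Compressions preserve positivity: the form of the image at \<open>v\<close> is the sum
  over l of the forms of the original block matrix at \<open>w l\<close>, the vector obtained by
  applying the coefficient matrix of row l to each block of \<open>v\<close>.\<close>

lemma cp_map_row_forms:
  fixes m :: nat
  assumes lin: "toeplitz_linear d n \<phi>"
    and \<phi>: "\<And>A p q. A \<in> toeplitz d \<Longrightarrow> p < n \<Longrightarrow> q < n \<Longrightarrow>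
      \<phi> A $$ (p, q) = (\<Sum>l<m. row_form d (Q l) A p q)"
  shows "cp_map d n \<phi>"
  unfolding cp_map_def psd_block_mat_iff
proof (intro conjI allI impI lin)
  fix k X
  assume X: "\<forall>p<k. \<forall>q<k. X p q \<in> toeplitz d"
    and psd: "psd_on ({..<k} \<times> {..<d}) (block_fun k d X)"
  show "psd_on ({..<k} \<times> {..<n}) (block_fun k n (\<lambda>p q. \<phi> (X p q)))"
    unfolding psd_on_def
  proof
    fix v :: "nat \<times> nat \<Rightarrow> complex"
    define w where "w l = (\<lambda>(p, a). \<Sum>r<n. coeff (Q l r) a * v (p, r))" for l
    have "sesq ({..<k} \<times> {..<n}) (block_fun k n (\<lambda>p q. \<phi> (X p q))) v =
      (\<Sum>p<k. \<Sum>r<n. \<Sum>q<k. \<Sum>s<n. \<Sum>l<m. \<Sum>a<d. \<Sum>b<d.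
        cnj (v (p, r)) * (cnj (coeff (Q l r) a) * X p q $$ (a, b) * coeff (Q l s) b) * v (q, s))"
      using X by (simp add: sesq_def sum.cartesian_product' block_fun_def \<phi> row_form_def
          sum_distrib_left sum_distrib_right)
    also have "\<dots> = (\<Sum>l<m. \<Sum>p<k. \<Sum>a<d. \<Sum>q<k. \<Sum>b<d. \<Sum>r<n. \<Sum>s<n.
        cnj (v (p, r)) * (cnj (coeff (Q l r) a) * X p q $$ (a, b) * coeff (Q l s) b) * v (q, s))"
      by (rule sum_reorder)
    also have "\<dots> = (\<Sum>l<m. sesq ({..<k} \<times> {..<d}) (block_fun k d X) (w l))"
      unfolding sesq_def sum.cartesian_product' block_fun_def w_def split_conv
      by (intro sum.cong refl) (simp only: cnj_sum_mult_sum, simp add: mult_ac)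
    also have "0 \<le> \<dots>" using psd by (intro sum_nonneg) (simp add: psd_on_def)
    finally show "0 \<le> sesq ({..<k} \<times> {..<n}) (block_fun k n (\<lambda>p q. \<phi> (X p q))) v" .
  qed
qed

text \<open>A Kraus decomposition on the Toeplitz system: the functional \<open>s\<close> encodes
  \<open>\<phi>\<close>, complete positivity at level \<open>n\<close> makes it positive, and each
  rank one summand of its representing kernel contributes one row polynomial.\<close>

lemma cp_map_imp_row_forms:
  assumes d: "1 \<le> d" and cp: "cp_map d n \<phi>"
  shows "\<exists>(m::nat) Q. (\<forall>l p. degree (Q l p) < d) \<and>
    (\<forall>A\<in>toeplitz d. \<forall>p<n. \<forall>q<n. \<phi> A $$ (p, q) = (\<Sum>l<m. row_form d (Q l) A p q))"
proof -
  have lin: "toeplitz_linear d n \<phi>" using cp by (simp add: cp_map_def)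
  note linD = toeplitz_linearD[OF lin]
  define I where "I = {..<n} \<times> {..<d}"
  define blk where "blk X p q = mat d d (\<lambda>(i, j). X (p, i) (q, j))"
    for X :: "nat \<times> nat \<Rightarrow> nat \<times> nat \<Rightarrow> complex" and p q
  define S where "S = {X. (\<forall>i j. i \<notin> I \<or> j \<notin> I \<longrightarrow> X i j = 0) \<and> (\<forall>p q. blk X p q \<in> toeplitz d)}"
  define s where "s X = (\<Sum>p<n. \<Sum>q<n. \<phi> (blk X p q) $$ (p, q))" for X
  have fin: "finite I" by (simp add: I_def)
  have blk_S: "blk X p q \<in> toeplitz d" if "X \<in> S" for X p q using that by (simp add: S_def)
  have blk_add: "blk (\<lambda>i j. X i j + Y i j) p q = blk X p q + blk Y p q" for X Y p q
    by (intro eq_matI) (auto simp: blk_def)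
  have blk_mult: "blk (\<lambda>i j. c * X i j) p q = c \<cdot>\<^sub>m blk X p q" for c X p q
    by (intro eq_matI) (auto simp: blk_def)
  have blk_adj: "blk (\<lambda>i j. cnj (X j i)) p q = mat d d (\<lambda>(i, j). cnj (blk X q p $$ (j, i)))" for X p q
    by (intro eq_matI) (auto simp: blk_def)
  have "\<exists>G. psd_on I G \<and> (\<forall>X\<in>S. s X = (\<Sum>i\<in>I. \<Sum>j\<in>I. X i j * G i j))"
  proof (rule positive_functional_representation[OF fin])
    show "(\<lambda>i j. X i j + Y i j) \<in> S" if "X \<in> S" "Y \<in> S" for X Y
      using that by (auto simp: S_def blk_add toeplitz_add)
    show "(\<lambda>i j. c * X i j) \<in> S" if "X \<in> S" for c X
      using that by (auto simp: S_def blk_mult toeplitz_smult)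
    show "(\<lambda>i j. cnj (X j i)) \<in> S" if "X \<in> S" for X
      using that by (auto simp: S_def blk_adj intro: toeplitz_adjoint)
    show "X i j = 0" if "X \<in> S" "i \<notin> I \<or> j \<notin> I" for X i j using that unfolding S_def by blast
    have "blk (\<lambda>i j. if i = j \<and> i \<in> I then 1 else 0) p q \<in> toeplitz d" for p q
      by (rule toeplitzI[where a = "\<lambda>m. if p = q \<and> p < n \<and> m = 0 then 1 else 0"])
        (auto simp: blk_def I_def)
    then show "(\<lambda>i j. if i = j \<and> i \<in> I then 1 else 0) \<in> S"
      by (simp add: S_def)
    have index: "p < n \<Longrightarrow> q < n \<Longrightarrow> X \<in> S \<Longrightarrow> p < dim_row (\<phi> (blk X p q)) \<and> q < dim_col (\<phi> (blk X p q))" for p q X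
      using linD(1)[OF blk_S] by (metis carrier_matD)
    show "s (\<lambda>i j. X i j + Y i j) = s X + s Y" if "X \<in> S" "Y \<in> S" for X Y
      unfolding s_def sum.distrib[symmetric] using that index
      by (intro sum.cong refl) (simp add: blk_add linD(2) blk_S)
    show "s (\<lambda>i j. c * X i j) = c * s X" if "X \<in> S" for c X
      unfolding s_def sum_distrib_left using that index
      by (intro sum.cong refl) (simp add: blk_mult linD(3) blk_S)
    show "0 \<le> s X" if X: "X \<in> S" and psd: "psd_on I X" for X
    proof -
      have "sesq I (block_fun n d (blk X)) v = sesq I X v" for v
        by (rule sesq_cong) (auto simp: I_def block_fun_def blk_def)
      then have "psd_mat (n * d) (block_mat n d (blk X))"
        using psd by (simp add: psd_block_mat_iff psd_on_def I_def)
      then have "psd_mat (n * n) (block_mat n n (\<lambda>p q. \<phi> (blk X p q)))"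
        using cp blk_S[OF X] by (simp add: cp_map_def)
      \<comment> \<open>The test vector is the sum of the e_p \<otimes> e_p; evaluating the form
        there collects exactly the entries (p, q) of the blocks (p, q), that is
        \<open>s X\<close>.\<close>
      then have "0 \<le> sesq ({..<n} \<times> {..<n}) (block_fun n n (\<lambda>p q. \<phi> (blk X p q)))
          (\<lambda>(p, a). if a = p then 1 else 0)"
        unfolding psd_block_mat_iff psd_on_def by blast
      also have "\<dots> = (\<Sum>p<n. \<Sum>r<n. \<Sum>q<n. \<Sum>t<n. if t = q then (if r = p then \<phi> (blk X p q) $$ (r, t) else 0) else 0)"
        unfolding sesq_def sum.cartesian_product' block_fun_def split_conv
        by (intro sum.cong refl) auto
      also have "\<dots> = (\<Sum>p<n. \<Sum>r<n. if r = p then (\<Sum>q<n. \<phi> (blk X p q) $$ (p, q)) else 0)"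
        by (intro sum.cong refl) (auto simp: sum.delta)
      also have "\<dots> = s X" by (simp add: s_def sum.delta)
      finally show ?thesis .
    qed
  qed
  then obtain G where psd: "psd_on I G"
    and G: "\<And>X. X \<in> S \<Longrightarrow> s X = (\<Sum>i\<in>I. \<Sum>j\<in>I. X i j * G i j)" by blast
  obtain m :: nat and g where g: "\<And>i j. i \<in> I \<Longrightarrow> j \<in> I \<Longrightarrow> G i j = (\<Sum>l<m. g l i * cnj (g l j))"
    using psd_on_sum_rank_one[OF fin psd] by blast
  \<comment> \<open>The conjugates match \<open>row_form\<close>, which conjugates its left factor,
    while the rank one kernels conjugate the right one.\<close>
  define Q where "Q l p = Poly (map (\<lambda>a. cnj (g l (p, a))) [0..<d])" for l p
  have coeff_Q: "coeff (Q l p) a = (if a < d then cnj (g l (p, a)) else 0)" for l p a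
    by (simp add: Q_def nth_default_def)
  have "degree (Q l p) \<le> d - 1" for l p
    by (rule degree_le) (use d in \<open>auto simp: coeff_Q\<close>)
  then have "degree (Q l p) < d" for l p
    using d by (metis Suc_diff_1 less_Suc_eq_le Suc_le_eq One_nat_def)
  moreover have "\<phi> A $$ (p, q) = (\<Sum>l<m. row_form d (Q l) A p q)"
    if A: "A \<in> toeplitz d" and pq: "p < n" "q < n" for A p q
  proof -
    \<comment> \<open>With \<open>A\<close> as its only block, at position (p, q), this kernel
      isolates a single entry of \<open>\<phi> A\<close> in \<open>s X\<close>.\<close>
    define X where "X = (\<lambda>(p', i) (q', j). if p' = p \<and> q' = q \<and> i < d \<and> j < d then A $$ (i, j) else 0)"
    have blk_X: "blk X p' q' = (if p' = p \<and> q' = q then A else 0\<^sub>m d d)" for p' q'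
      using toeplitz_carrier[OF A] by (intro eq_matI) (auto simp: blk_def X_def)
    have X_S: "X \<in> S" using pq by (auto simp: S_def blk_X A toeplitz_zero) (auto simp: X_def I_def)
    have "s X = (\<Sum>p'<n. \<Sum>q'<n. if q' = q then (if p' = p then \<phi> A $$ (p, q) else 0) else 0)"
      unfolding s_def blk_X by (intro sum.cong refl) (auto simp: linD(4))
    also have "\<dots> = \<phi> A $$ (p, q)" using pq by (simp add: sum.delta)
    finally have "\<phi> A $$ (p, q) = (\<Sum>i\<in>I. \<Sum>j\<in>I. X i j * G i j)" using G[OF X_S] by simp
    also have "\<dots> = (\<Sum>p'<n. \<Sum>a<d. \<Sum>q'<n. if q' = q then
        (\<Sum>b<d. if p' = p then A $$ (a, b) * G (p, a) (q, b) else 0) else 0)"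
      unfolding I_def sum.cartesian_product' by (intro sum.cong refl) (auto simp: X_def intro!: sum.cong)
    also have "\<dots> = (\<Sum>p'<n. if p' = p then (\<Sum>a<d. \<Sum>b<d. A $$ (a, b) * G (p, a) (q, b)) else 0)"
      using pq by (intro sum.cong refl) (auto simp: sum.delta)
    also have "\<dots> = (\<Sum>a<d. \<Sum>b<d. A $$ (a, b) * G (p, a) (q, b))" using pq by (simp add: sum.delta)
    also have "\<dots> = (\<Sum>a<d. \<Sum>b<d. \<Sum>l<m. cnj (coeff (Q l p) a) * A $$ (a, b) * coeff (Q l q) b)"
      using pq by (intro sum.cong refl) (simp add: g I_def coeff_Q sum_distrib_left mult_ac)
    also have "\<dots> = (\<Sum>a<d. \<Sum>l<m. \<Sum>b<d. cnj (coeff (Q l p) a) * A $$ (a, b) * coeff (Q l q) b)"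
      by (intro sum.cong refl sum.swap)
    also have "\<dots> = (\<Sum>l<m. row_form d (Q l) A p q)" unfolding row_form_def by (rule sum.swap)
    finally show ?thesis .
  qed
  ultimately show ?thesis by blast
qed

section \<open>Polynomials on the unit circle\<close>

text \<open>A rotated injective sequence on the circle meets a finite set only finitely often. It
  serves to carry inequalities on the circle across finitely many exceptional points by
  continuity.\<close>

lemma circle_approach:
  assumes "cmod \<zeta> = 1" "finite F"
  shows "\<exists>X. (\<forall>n. cmod (X n) = 1) \<and> (\<forall>\<^sub>F n in sequentially. X n \<notin> F) \<and> X \<longlonglongrightarrow> \<zeta>"
proof -
  define e where "e n = inverse (real (Suc n))" for n
  have e: "e \<longlonglongrightarrow> 0" unfolding e_def by (rule LIMSEQ_inverse_real_of_nat)
  have e1: "0 \<le> e n" "e n \<le> 1" for n by (auto simp: e_def field_simps)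
  define Y where "Y n = Complex (sqrt (1 - (e n)\<^sup>2)) (e n)" for n
  have "cmod (Y n) = 1" for n
    using e1[of n] by (simp add: Y_def cmod_def power_le_one abs_square_le_1)
  then have norm: "cmod (\<zeta> * Y n) = 1" for n using assms(1) by (simp add: norm_mult)
  have "(\<lambda>n. Complex (sqrt (1 - (e n)\<^sup>2)) (e n)) \<longlonglongrightarrow> Complex (sqrt (1 - 0\<^sup>2)) 0"
    by (intro tendsto_intros e)
  then have "Y \<longlonglongrightarrow> 1" by (simp add: Y_def[abs_def] one_complex.code)
  then have lim: "(\<lambda>n. \<zeta> * Y n) \<longlonglongrightarrow> \<zeta>" using tendsto_mult_left by fastforce
  have "inj (\<lambda>n. \<zeta> * Y n)"
  proof (rule injI)
    fix m n assume "\<zeta> * Y m = \<zeta> * Y n"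
    then have "Y m = Y n" using assms(1) by auto
    then show "m = n" by (simp add: Y_def e_def)
  qed
  then have "finite ((\<lambda>n. \<zeta> * Y n) -` F)" using assms(2) by (rule finite_vimageI[rotated])
  then have "\<forall>\<^sub>F n in sequentially. \<zeta> * Y n \<notin> F"
    by (simp add: cofinite_eq_sequentially[symmetric] eventually_cofinite vimage_def)
  then show ?thesis using norm lim by (intro exI[of _ "\<lambda>n. \<zeta> * Y n"]) simp
qed

lemma infinite_circle: "infinite {z. cmod z = 1}"
proof
  assume fin: "finite {z. cmod z = 1}"
  obtain X where "\<forall>n. cmod (X n) = 1" "\<forall>\<^sub>F n in sequentially. X n \<notin> {z. cmod z = 1}"
    using circle_approach[of 1, OF _ fin] by auto
  then show False by simp
qed

lemma poly_zero_on_circle: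
  assumes "\<And>z. cmod z = 1 \<Longrightarrow> poly p z = 0" shows "p = 0"
  using poly_roots_finite[of p] infinite_circle finite_subset[of "{z. cmod z = 1}" "{z. poly p z = 0}"] assms
  by blast

lemma cmod_poly_le_on_circle:
  assumes "finite F" "\<And>z. cmod z = 1 \<Longrightarrow> z \<notin> F \<Longrightarrow> cmod (poly r z) \<le> cmod (poly g z)" "cmod \<zeta> = 1"
  shows "cmod (poly r \<zeta>) \<le> cmod (poly g \<zeta>)"
proof -
  obtain X where X: "\<forall>n. cmod (X n) = 1" "\<forall>\<^sub>F n in sequentially. X n \<notin> F" "X \<longlonglongrightarrow> \<zeta>"
    using circle_approach[OF assms(3,1)] by blast
  have "(\<lambda>n. cmod (poly p (X n))) \<longlonglongrightarrow> cmod (poly p \<zeta>)" for p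
    by (intro tendsto_norm isCont_tendsto_compose[OF _ X(3)]) simp
  moreover have "\<forall>\<^sub>F n in sequentially. cmod (poly r (X n)) \<le> cmod (poly g (X n))"
    using X(2) by eventually_elim (use X(1) assms(2) in auto)
  ultimately show ?thesis by (intro tendsto_le[OF sequentially_bot])
qed

text \<open>At a zero \<zeta> of \<open>g\<close>, which lies on the circle, domination forces
  \<open>r\<close> to vanish. Cancelling z - \<zeta> from both keeps the inequality except possibly
  at \<zeta>, which joins the exceptional set \<open>F\<close>; the degree of \<open>g\<close>
  drops.\<close>

lemma poly_dvd_if_dominates_on_circle:
  fixes g r :: "complex poly"
  assumes "g \<noteq> 0" "\<And>z. poly g z = 0 \<Longrightarrow> cmod z = 1"
    and "finite F" "\<And>z. cmod z = 1 \<Longrightarrow> z \<notin> F \<Longrightarrow> cmod (poly r z) \<le> cmod (poly g z)"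
  shows "g dvd r"
  using assms
proof (induction "degree g" arbitrary: g r F)
  case 0
  then have "is_unit g" by (simp add: is_unit_iff_degree)
  then show ?case by (rule unit_imp_dvd)
next
  case (Suc k)
  have "\<not> constant (poly g)" using Suc.hyps(2) by (simp add: constant_degree)
  then obtain \<zeta> where \<zeta>: "poly g \<zeta> = 0" using fundamental_theorem_of_algebra by blast
  then have circ: "cmod \<zeta> = 1" using Suc.prems by blast
  have "poly r \<zeta> = 0"
    using cmod_poly_le_on_circle[OF Suc.prems(3,4) circ] \<zeta> by simp
  then obtain g' r' where g': "g = [:-\<zeta>, 1:] * g'" and r': "r = [:-\<zeta>, 1:] * r'"
    using \<zeta> by (auto simp: poly_eq_0_iff_dvd elim!: dvdE)
  have nz: "g' \<noteq> 0" using g' Suc.prems(1) by auto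
  have "degree g = Suc (degree g')" unfolding g' using nz by (subst degree_mult_eq) auto
  then have "k = degree g'" using Suc.hyps(2) by simp
  moreover have "cmod (poly r' z) \<le> cmod (poly g' z)" if "cmod z = 1" "z \<notin> insert \<zeta> F" for z
  proof -
    have "cmod (z - \<zeta>) * cmod (poly r' z) \<le> cmod (z - \<zeta>) * cmod (poly g' z)"
      using Suc.prems(4)[of z] that by (simp add: g' r' norm_mult[symmetric] algebra_simps)
    moreover have "0 < cmod (z - \<zeta>)" using that by simp
    ultimately show ?thesis by simp
  qed
  ultimately have "g' dvd r'"
    using Suc.hyps(1)[of g' "insert \<zeta> F" r'] nz Suc.prems(2,3) by (auto simp: g')
  then show ?case unfolding g' r' by (rule mult_dvd_mono[OF dvd_refl])
qed

text \<open>Domination makes the rows pointwise parallel, so \<open>h k * g = r * q k\<close> with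
  \<open>g\<close> the greatest common divisor. Then \<open>r\<close> is dominated by
  \<open>g\<close>, hence divisible by it, and the degree bound on \<open>h\<close> leaves only a
  constant quotient.\<close>

lemma row_dominated_imp_proportional:
  fixes q h :: "nat \<Rightarrow> complex poly"
  assumes roots: "\<And>z. poly (Gcd (q ` {..<n})) z = 0 \<Longrightarrow> cmod z = 1"
    and j: "j < n" "q j \<noteq> 0" "degree (q j) = N"
    and deg: "\<And>k. k < n \<Longrightarrow> degree (h k) \<le> N"
    and dom: "\<And>z c. cmod z = 1 \<Longrightarrow>
      cmod (\<Sum>k<n. c k * poly (h k) z) \<le> cmod (\<Sum>k<n. c k * poly (q k) z)"
  shows "\<exists>c. \<forall>k<n. h k = smult c (q k)"
proof -
  define g where "g = Gcd (q ` {..<n})"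
  have cross: "h j * q k = h k * q j" if k: "k < n" for k
  proof -
    have "poly (h j * q k - h k * q j) z = 0" if z: "cmod z = 1" for z
    proof -
      \<comment> \<open>These coefficients annihilate the row \<open>q\<close> at z, so by
        domination they annihilate \<open>h\<close> there as well.\<close>
      define c where "c i = (if i = j then poly (q k) z else 0) - (if i = k then poly (q j) z else 0)" for i
      have "(\<Sum>i<n. c i * poly (f i) z) = poly (q k) z * poly (f j) z - poly (q j) z * poly (f k) z" for f
        using j(1) k by (simp add: c_def left_diff_distrib sum_subtractf if_distrib[of "\<lambda>x. x * _"] cong: if_cong)
      then show ?thesis using dom[OF z, of c] by (simp add: mult.commute)
    qed
    then show ?thesis using poly_zero_on_circle[of "h j * q k - h k * q j"] by simp
  qed
  \<comment> \<open>By \<open>cross\<close>, \<open>q j\<close> divides every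
    \<open>h j * q k\<close>, hence also their greatest common divisor, which is
    \<open>h j * g\<close> up to a unit.\<close>
  have "q j dvd Gcd ((*) (h j) ` (q ` {..<n}))"
    by (rule Gcd_greatest) (auto simp: cross)
  then have "q j dvd h j * g" by (simp add: Gcd_mult g_def)
  then obtain r where r: "h j * g = q j * r" by (rule dvdE)
  have hk: "h k * g = r * q k" if "k < n" for k
  proof -
    have "q j * (h k * g) = q j * (r * q k)"
      using cross[OF that] r by (metis mult.assoc mult.commute)
    then show ?thesis using j(2) by simp
  qed
  have g_dvd: "g dvd q j" unfolding g_def using j(1) by (intro Gcd_dvd) auto
  then have g0: "g \<noteq> 0" using j(2) by auto
  have "g dvd r"
  proof (rule poly_dvd_if_dominates_on_circle[OF g0])
    show "finite {z. poly (q j) z = 0}" using j(2) by (rule poly_roots_finite)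
    fix z assume z: "cmod z = 1" "z \<notin> {z. poly (q j) z = 0}"
    have "(\<Sum>k<n. (if k = j then 1 else 0) * poly (f k) z) = poly (f j) z" for f
      using j(1) by (simp add: if_distrib[of "\<lambda>x. x * _"] cong: if_cong)
    then have "cmod (poly (h j) z) \<le> cmod (poly (q j) z)"
      using dom[OF z(1), of "\<lambda>k. if k = j then 1 else 0"] by simp
    then have "cmod (poly (h j) z) * cmod (poly g z) \<le> cmod (poly (q j) z) * cmod (poly g z)"
      by (rule mult_right_mono) simp
    moreover have "cmod (poly (h j) z) * cmod (poly g z) = cmod (poly (q j) z) * cmod (poly r z)"
      using r by (metis norm_mult poly_mult)
    ultimately show "cmod (poly r z) \<le> cmod (poly g z)" using z(2) by simp
  qed (use roots g_def in auto)
  then obtain c where c: "r = g * c" by (rule dvdE)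
  have hc: "h k = c * q k" if "k < n" for k
  proof -
    have "g * h k = g * (c * q k)" using hk[OF that] c by (simp add: mult_ac)
    then show ?thesis using g0 by simp
  qed
  have "degree c = 0"
  proof (cases "c = 0")
    case False
    then have "degree (h j) = degree c + degree (q j)" using hc[OF j(1)] j(2) by (simp add: degree_mult_eq)
    then show ?thesis using deg[OF j(1)] j(3) by simp
  qed simp
  then obtain a where "c = [:a:]" by (rule degree_eq_zeroE)
  then show ?thesis using hc by auto
qed

section \<open>Pure maps\<close>

lemma row_form_smult_row:
  "row_form d (\<lambda>p. smult c (Q p)) A p q = c * cnj c * row_form d Q A p q"
  by (simp add: row_form_def sum_distrib_left mult_ac)

lemma row_form_cong:
  assumes "Q p = R p" "Q q = R q" shows "row_form d Q A p q = row_form d R A p q"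
  using assms by (simp add: row_form_def)

text \<open>A Toeplitz form does not change when both coefficient sequences are shifted by one
  place. The squared terms in x and y thus share the factor \<open>W0\<close>, and only the
  coefficients of |x + y z|^2 on the circle remain.\<close>

lemma row_form_linear_factor:
  assumes A: "A \<in> toeplitz d" and deg: "degree (w p) + 1 < d" "degree (w q) + 1 < d"
  shows "\<exists>W0 W1 W2. \<forall>x y. row_form d (\<lambda>p. [:x, y:] * w p) A p q =
    (cnj x * x + cnj y * y) * W0 + cnj x * y * W1 + cnj (cnj x * y) * W2"
proof -
  obtain a where a: "A = mat d d (\<lambda>(i, j). a (int i - int j))" using A by (rule toeplitzE)
  define e where "e p i = coeff (pCons 0 (w p)) i" for p i
  define W where "W f g = (\<Sum>i<d. \<Sum>j<d. cnj (f i) * a (int i - int j) * g j)" for f g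
  obtain d' where d: "d = Suc d'" using deg by (cases d) auto
  \<comment> \<open>The top coefficients vanish, so no term is lost by shifting inside the first
    \<open>d\<close> places.\<close>
  have z: "coeff (w p) d' = 0" "coeff (w q) d' = 0" using deg d by (auto intro: coeff_eq_0)
  have "W (e p) (e q) = (\<Sum>i<d'. \<Sum>j<d'. cnj (coeff (w p) i) * a (int i - int j) * coeff (w q) j)"
    unfolding W_def d sum.lessThan_Suc_shift e_def by simp
  also have "\<dots> = W (coeff (w p)) (coeff (w q))"
    unfolding W_def d by (simp add: z)
  finally have shift: "W (e p) (e q) = W (coeff (w p)) (coeff (w q))" .
  have co: "coeff ([:x, y:] * w p) i = x * coeff (w p) i + y * e p i" for x y p i
    by (simp add: e_def coeff_pCons split: nat.split)
  have "row_form d (\<lambda>p. [:x, y:] * w p) A p q =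
    (cnj x * x + cnj y * y) * W (coeff (w p)) (coeff (w q)) + cnj x * y * W (coeff (w p)) (e q)
      + cnj (cnj x * y) * W (e p) (coeff (w q))" for x y
  proof -
    have "row_form d (\<lambda>p. [:x, y:] * w p) A p q =
        (\<Sum>i<d. \<Sum>j<d. cnj (coeff ([:x, y:] * w p) i) * a (int i - int j) * coeff ([:x, y:] * w q) j)"
      unfolding row_form_def a by (intro sum.cong refl) auto
    also have "\<dots> = cnj x * x * W (coeff (w p)) (coeff (w q)) + cnj y * y * W (e p) (e q)
        + cnj x * y * W (coeff (w p)) (e q) + cnj (cnj x * y) * W (e p) (coeff (w q))"
      unfolding co W_def sum_distrib_left sum.distrib[symmetric]
      by (intro sum.cong refl) (simp add: algebra_simps)
    finally show ?thesis unfolding shift by (simp add: algebra_simps)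
  qed
  then show ?thesis by blast
qed

text \<open>Each summand of a decomposition into compressions lies below \<open>\<phi>\<close>. A
  nonzero one is therefore a positive multiple of \<open>\<phi>\<close>, and rescaling its row gives
  \<open>\<phi>\<close> itself.\<close>

lemma pure_imp_single_row:
  assumes d: "1 \<le> d" and pure: "pure_cp_map d n \<phi>"
  shows "\<exists>Q. (\<forall>p. degree (Q p) < d) \<and>
    (\<forall>A\<in>toeplitz d. \<forall>p<n. \<forall>q<n. \<phi> A $$ (p, q) = row_form d Q A p q)"
proof -
  have cp: "cp_map d n \<phi>" using pure by (simp add: pure_cp_map_def)
  then have lin: "toeplitz_linear d n \<phi>" by (simp add: cp_map_def)
  obtain m :: nat and R where deg: "\<And>l p. degree (R l p) < d"
    and R: "\<And>A p q. A \<in> toeplitz d \<Longrightarrow> p < n \<Longrightarrow> q < n \<Longrightarrow>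
      \<phi> A $$ (p, q) = (\<Sum>l<m. row_form d (R l) A p q)"
    using cp_map_imp_row_forms[OF d cp] by blast
  obtain A0 where A0: "A0 \<in> toeplitz d" "\<phi> A0 \<noteq> 0\<^sub>m n n"
    using pure by (auto simp: pure_cp_map_def)
  have "\<exists>p<n. \<exists>q<n. \<phi> A0 $$ (p, q) \<noteq> 0"
  proof (rule ccontr)
    assume "\<not> ?thesis"
    then have "\<phi> A0 = 0\<^sub>m n n" using toeplitz_linearD(1)[OF lin A0(1)] by (intro eq_matI) auto
    then show False using A0(2) by simp
  qed
  then obtain p0 q0 where pq0: "p0 < n" "q0 < n" "\<phi> A0 $$ (p0, q0) \<noteq> 0" by blast
  then have "(\<Sum>l<m. row_form d (R l) A0 p0 q0) \<noteq> 0" using R[OF A0(1)] by simp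
  then obtain l where l: "l < m" "row_form d (R l) A0 p0 q0 \<noteq> 0"
    by (metis (no_types, lifting) lessThan_iff sum.neutral)
  have \<psi>: "cp_map d n (row_map d n (R l))"
    by (rule cp_map_row_forms[OF toeplitz_linear_row_map, where m = 1 and Q = "\<lambda>_. R l"])
      (simp add: row_map_def)
  \<comment> \<open>Replacing row l by the zero row, rather than deleting it, keeps the same index
    range for the remaining sum.\<close>
  have "cp_map d n (\<lambda>A. \<phi> A - row_map d n (R l) A)"
  proof (rule cp_map_row_forms[OF toeplitz_linear_diff[OF lin toeplitz_linear_row_map]])
    fix A p q assume A: "A \<in> toeplitz d" and pq: "p < n" "q < n"
    have "(\<Sum>k<m. row_form d (R k) A p q) =
        row_form d (R l) A p q + (\<Sum>k\<in>{..<m} - {l}. row_form d (R k) A p q)"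
      using l(1) by (intro sum.remove) auto
    moreover have "(\<Sum>k<m. row_form d ((R(l := \<lambda>_. 0)) k) A p q) =
        row_form d (\<lambda>_. 0) A p q + (\<Sum>k\<in>{..<m} - {l}. row_form d (R k) A p q)"
      using l(1) by (subst sum.remove[of _ l]) (auto intro!: sum.cong)
    moreover have "row_form d (\<lambda>_. 0) A p q = 0" by (simp add: row_form_def)
    moreover have "(\<phi> A - row_map d n (R l) A) $$ (p, q) = \<phi> A $$ (p, q) - row_form d (R l) A p q"
      using pq by (simp add: row_map_def)
    ultimately show "(\<phi> A - row_map d n (R l) A) $$ (p, q) =
        (\<Sum>k<m. row_form d ((R(l := \<lambda>_. 0)) k) A p q)"
      using R[OF A pq] by simp
  qed
  then obtain t :: real where t: "0 \<le> t"
    "\<And>A. A \<in> toeplitz d \<Longrightarrow> row_map d n (R l) A = of_real t \<cdot>\<^sub>m \<phi> A"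
    using pure \<psi> unfolding pure_cp_map_def cp_le_def by blast
  have entry: "row_form d (R l) A p q = of_real t * \<phi> A $$ (p, q)"
    if "A \<in> toeplitz d" "p < n" "q < n" for A p q
  proof -
    have "row_map d n (R l) A $$ (p, q) = (of_real t \<cdot>\<^sub>m \<phi> A) $$ (p, q)" using t(2)[OF that(1)] by simp
    then show ?thesis using that toeplitz_linearD(1)[OF lin that(1)] by (simp add: row_map_def)
  qed
  then have "t \<noteq> 0" using l(2) A0(1) pq0 by fastforce
  with t(1) have "t > 0" by simp
  define c where "c = complex_of_real (1 / sqrt t)"
  have c: "c * cnj c * of_real t = 1"
    using \<open>t > 0\<close> by (simp add: c_def flip: of_real_mult)
  have "\<phi> A $$ (p, q) = row_form d (\<lambda>p. smult c (R l p)) A p q"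
    if "A \<in> toeplitz d" "p < n" "q < n" for A p q
    unfolding row_form_smult_row entry[OF that] mult.assoc[symmetric] c by simp
  moreover have "degree (smult c (R l p)) < d" for p using deg[of l p] degree_smult_le[of c "R l p"] by simp
  ultimately show ?thesis by (intro exI[of _ "\<lambda>p. smult c (R l p)"]) blast
qed

text \<open>The hypotheses \<open>split\<close> say that |x + y z|^2 = |x1 + y1 z|^2 + |x2 + y2 z|^2
  on the circle, which splits \<open>\<phi>\<close> into two compressions. Purity makes the first
  one a multiple of \<open>\<phi>\<close>; comparing densities at (k, k) and cancelling
  \<open>w k\<close> makes the first square a multiple of |x + y z|^2.\<close>

lemma pure_splitting_proportional:
  fixes x y x1 y1 x2 y2 :: complex
  assumes d: "1 \<le> d" and pure: "pure_cp_map d n \<phi>"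
    and \<phi>: "\<And>A p q. A \<in> toeplitz d \<Longrightarrow> p < n \<Longrightarrow> q < n \<Longrightarrow>
      \<phi> A $$ (p, q) = row_form d (\<lambda>p. [:x, y:] * w p) A p q"
    and deg: "\<And>p. p < n \<Longrightarrow> degree (w p) + 1 < d"
    and k: "k < n" "w k \<noteq> 0"
    and split: "cnj x * x + cnj y * y = cnj x1 * x1 + cnj y1 * y1 + (cnj x2 * x2 + cnj y2 * y2)"
      "cnj x * y = cnj x1 * y1 + cnj x2 * y2"
  shows "\<exists>t::real. cnj x1 * x1 + cnj y1 * y1 = of_real t * (cnj x * x + cnj y * y) \<and>
    cnj x1 * y1 = of_real t * (cnj x * y)"
proof -
  have lin: "toeplitz_linear d n \<phi>" using pure by (simp add: pure_cp_map_def cp_map_def)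
  define Q1 where "Q1 p = [:x1, y1:] * w p" for p
  define Q2 where "Q2 p = [:x2, y2:] * w p" for p
  have sum: "\<phi> A $$ (p, q) = row_form d Q1 A p q + row_form d Q2 A p q"
    if A: "A \<in> toeplitz d" and pq: "p < n" "q < n" for A p q
  proof -
    obtain W0 W1 W2 where W: "\<And>x y. row_form d (\<lambda>p. [:x, y:] * w p) A p q =
        (cnj x * x + cnj y * y) * W0 + cnj x * y * W1 + cnj (cnj x * y) * W2"
      using row_form_linear_factor[OF A deg[OF pq(1)] deg[OF pq(2)]] by blast
    show ?thesis
      unfolding \<phi>[OF A pq] Q1_def Q2_def W split by (simp add: algebra_simps)
  qed
  have 1: "cp_map d n (row_map d n Q1)"
    by (rule cp_map_row_forms[OF toeplitz_linear_row_map, where m = 1 and Q = "\<lambda>_. Q1"])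
      (simp add: row_map_def)
  have 2: "cp_map d n (\<lambda>A. \<phi> A - row_map d n Q1 A)"
  proof (rule cp_map_row_forms[OF toeplitz_linear_diff[OF lin toeplitz_linear_row_map], where m = 1 and Q = "\<lambda>_. Q2"])
    fix A p q assume "A \<in> toeplitz d" "p < n" "q < n"
    then show "(\<phi> A - row_map d n Q1 A) $$ (p, q) = (\<Sum>l<(1::nat). row_form d Q2 A p q)"
      using sum by (simp add: row_map_def)
  qed
  obtain t :: real where t: "\<And>A. A \<in> toeplitz d \<Longrightarrow> row_map d n Q1 A = of_real t \<cdot>\<^sub>m \<phi> A"
    using pure 1 2 unfolding pure_cp_map_def cp_le_def by blast
  have degs: "degree ([:a, b:] * w k) < d" for a b
    using degree_mult_le[of "[:a, b:]" "w k"] deg[OF k(1)] degree_pCons_le[of a "[:b:]"] by simp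
  have circ: "cnj (poly (Q1 k) z) * poly (Q1 k) z =
      of_real t * (cnj (poly ([:x, y:] * w k) z) * poly ([:x, y:] * w k) z)" if z: "cmod z = 1" for z
  proof -
    have "poly_density d n (row_map d n Q1) z $$ (k, k) = cnj (poly (Q1 k) z) * poly (Q1 k) z"
      using poly_density_row_forms[OF k(1) k(1) z, where m = 1 and Q = "\<lambda>_. Q1" and \<phi> = "row_map d n Q1"] degs k
      by (simp add: row_map_def Q1_def)
    moreover have "poly_density d n \<phi> z $$ (k, k) =
        cnj (poly ([:x, y:] * w k) z) * poly ([:x, y:] * w k) z"
      using poly_density_row_forms[OF k(1) k(1) z, where m = 1 and Q = "\<lambda>_ p. [:x, y:] * w p" and \<phi> = \<phi>]
        degs \<phi> k by (simp del: poly_mult mult_pCons_left)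
    moreover have "poly_density d n (row_map d n Q1) z $$ (k, k) = of_real t * poly_density d n \<phi> z $$ (k, k)"
    proof -
      have "row_map d n Q1 A $$ (k, k) = of_real t * \<phi> A $$ (k, k)" if "A \<in> toeplitz d" for A
        unfolding t[OF that] using toeplitz_linearD(1)[OF lin that] k(1) by simp
      then show ?thesis using k(1)
        by (simp add: poly_density_def toeplitz_one shift_mat_pow_toeplitz mat_adjoint_shift_pow_toeplitz
            sum_distrib_left algebra_simps)
    qed
    ultimately show ?thesis by simp
  qed
  \<comment> \<open>\<open>z * \<bar>a + b z\<bar>\<^sup>2\<close> is a polynomial on the unit circle\<close>
  define N where "N a b = [:a * cnj b, cnj a * a + cnj b * b, cnj a * b:]" for a b :: complex
  have N: "poly (N a b) z = z * (cnj (poly [:a, b:] z) * poly [:a, b:] z)" if z: "cmod z = 1" for a b z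
  proof -
    have "z * cnj z = 1" using complex_norm_square[of z] z by simp
    then have "z * (cnj (a + z * b) * (a + z * b)) = (cnj a * z + cnj b) * (a + z * b)"
      by (simp add: algebra_simps)
    then show ?thesis by (simp add: N_def algebra_simps)
  qed
  \<comment> \<open>The extra factor \<open>w k\<close> covers its own zeros on the circle; it is
    cancelled only after passing to an identity of polynomials.\<close>
  have "poly (w k * (N x1 y1 - smult (of_real t) (N x y))) z = 0" if z: "cmod z = 1" for z
  proof (cases "poly (w k) z = 0")
    case False
    have "cnj (poly (w k) z) * poly (w k) z * (cnj (poly [:x1, y1:] z) * poly [:x1, y1:] z) =
      cnj (poly (w k) z) * poly (w k) z * (of_real t * (cnj (poly [:x, y:] z) * poly [:x, y:] z))"
      using circ[OF z] unfolding Q1_def poly_mult complex_cnj_mult by (simp only: mult_ac)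
    then have "cnj (poly [:x1, y1:] z) * poly [:x1, y1:] z =
        of_real t * (cnj (poly [:x, y:] z) * poly [:x, y:] z)"
      using False by (simp only: mult_cancel_left complex_cnj_zero_iff mult_eq_0_iff simp_thms)
    then show ?thesis unfolding poly_mult poly_diff poly_smult N[OF z] by simp
  qed simp
  then have "w k * (N x1 y1 - smult (of_real t) (N x y)) = 0" by (rule poly_zero_on_circle)
  then have "N x1 y1 = smult (of_real t) (N x y)" using k(2) by simp
  then show ?thesis by (intro exI[of _ t]) (simp add: N_def)
qed

section \<open>Row polynomials and the two implications\<close>

lemma mat_adjoint_mult_row_entry:
  assumes "R \<in> carrier_mat 1 n" "p < n" "q < n"
  shows "(mat_adjoint R * R) $$ (p, q) = cnj (R $$ (0, p)) * R $$ (0, q)"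
  using assms mat_adjoint_index[of p R 0] by (simp add: times_mat_def scalar_prod_def mat_adjoint_def)

lemma row_degree_eq: "Q \<in> carrier_mat 1 n \<Longrightarrow> row_degree Q = Max ((\<lambda>j. degree (Q $$ (0, j))) ` {..<n})"
  by (auto simp: row_degree_def intro!: arg_cong[where f = Max])

lemma row_gcd_eq: "Q \<in> carrier_mat 1 n \<Longrightarrow> row_gcd Q = Gcd ((\<lambda>j. Q $$ (0, j)) ` {..<n})"
  by (auto simp: row_gcd_def intro!: arg_cong[where f = Gcd])

lemma row_eval_density:
  assumes "Q \<in> carrier_mat 1 n" "p < n" "q < n"
  shows "(mat_adjoint (eval_row Q z) * eval_row Q z) $$ (p, q) =
    cnj (poly (Q $$ (0, p)) z) * poly (Q $$ (0, q)) z"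
proof -
  have "eval_row Q z \<in> carrier_mat 1 n" using assms(1) by (simp add: eval_row_def)
  then show ?thesis using assms by (subst mat_adjoint_mult_row_entry) (auto simp: eval_row_def)
qed

lemma pure_if_row:
  assumes d: "1 \<le> d" and n: "1 \<le> n" and ucp: "ucp_map d n \<phi>"
    and Q: "Q \<in> carrier_mat 1 n" "Q \<noteq> 0\<^sub>m 1 n" "row_degree Q = d - 1"
    and density: "\<And>z. cmod z = 1 \<Longrightarrow> poly_density d n \<phi> z = mat_adjoint (eval_row Q z) * eval_row Q z"
    and roots: "\<And>z. poly (row_gcd Q) z = 0 \<Longrightarrow> cmod z = 1"
  shows "pure_cp_map d n \<phi>"
proof -
  have cp: "cp_map d n \<phi>" and unit: "\<phi> (1\<^sub>m d) = 1\<^sub>m n" using ucp by (auto simp: ucp_map_def)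
  then have lin: "toeplitz_linear d n \<phi>" by (simp add: cp_map_def)
  define f where "f j = Q $$ (0, j)" for j
  \<comment> \<open>An entry attaining the maximal degree may be zero when \<open>d = 1\<close>,
    since the zero polynomial has degree 0; then any nonzero entry of \<open>Q\<close> serves
    instead.\<close>
  have "\<exists>j<n. f j \<noteq> 0 \<and> degree (f j) = d - 1"
  proof -
    have max: "Max ((\<lambda>j. degree (f j)) ` {..<n}) = d - 1"
      using Q(3) row_degree_eq[OF Q(1)] by (simp add: f_def)
    moreover have "Max ((\<lambda>j. degree (f j)) ` {..<n}) \<in> (\<lambda>j. degree (f j)) ` {..<n}"
      using n by (intro Max_in) (auto simp: lessThan_empty_iff)
    ultimately obtain j where j: "j < n" "degree (f j) = d - 1" by auto
    obtain k where k: "k < n" "f k \<noteq> 0"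
    proof (rule ccontr)
      assume "\<not> thesis"
      then have "Q = 0\<^sub>m 1 n" using that Q(1) by (intro eq_matI) (auto simp: f_def)
      then show False using Q(2) by simp
    qed
    have "degree (f k) \<le> d - 1" unfolding max[symmetric] using k by (intro Max_ge) auto
    then show ?thesis using j k by (cases "f j = 0") auto
  qed
  then obtain j where j: "j < n" "f j \<noteq> 0" "degree (f j) = d - 1" by blast
  have groots: "cmod z = 1" if "poly (Gcd (f ` {..<n})) z = 0" for z
    using roots[of z] that row_gcd_eq[OF Q(1)] by (simp add: f_def[abs_def])
  have "\<exists>t::real. 0 \<le> t \<and> t \<le> 1 \<and> (\<forall>A\<in>toeplitz d. \<psi> A = of_real t \<cdot>\<^sub>m \<phi> A)"
    if \<psi>: "cp_map d n \<psi>" "cp_le d n \<psi> \<phi>" for \<psi>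
  proof -
    have lin\<psi>: "toeplitz_linear d n \<psi>" using \<psi>(1) by (simp add: cp_map_def)
    obtain m1 :: nat and R1 where R1: "\<And>l p. degree (R1 l p) < d"
      "\<And>A p q. A \<in> toeplitz d \<Longrightarrow> p < n \<Longrightarrow> q < n \<Longrightarrow> \<psi> A $$ (p, q) = (\<Sum>l<m1. row_form d (R1 l) A p q)"
      using cp_map_imp_row_forms[OF d \<psi>(1)] by blast
    obtain m2 :: nat and R2 where R2: "\<And>l p. degree (R2 l p) < d"
      "\<And>A p q. A \<in> toeplitz d \<Longrightarrow> p < n \<Longrightarrow> q < n \<Longrightarrow> (\<phi> A - \<psi> A) $$ (p, q) = (\<Sum>l<m2. row_form d (R2 l) A p q)"
      using cp_map_imp_row_forms[OF d \<psi>(2)[unfolded cp_le_def]] by blast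
    \<comment> \<open>The rows of \<open>\<psi>\<close> followed by those of
      \<open>\<phi> - \<psi>\<close>, together a decomposition of \<open>\<phi>\<close>.\<close>
    define R where "R l = (if l < m1 then R1 l else R2 (l - m1))" for l
    have split: "(\<Sum>l<m1 + m2. F (R l)) = (\<Sum>l<m1. F (R1 l)) + (\<Sum>l<m2. F (R2 l))" for F :: "_ \<Rightarrow> complex"
    proof -
      have "(\<Sum>l<m1 + m2. F (R l)) = (\<Sum>l<m1. F (R l)) + (\<Sum>l<m2. F (R (l + m1)))"
        by (induction m2) (auto simp: add.assoc add.commute)
      then show ?thesis by (simp add: R_def)
    qed
    have degR: "degree (R l p) < d" for l p using R1(1) R2(1) by (simp add: R_def)
    have \<phi>R: "\<phi> A $$ (p, q) = (\<Sum>l<m1 + m2. row_form d (R l) A p q)"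
      if A: "A \<in> toeplitz d" and pq: "p < n" "q < n" for A p q
    proof -
      have "\<phi> A $$ (p, q) = \<psi> A $$ (p, q) + (\<phi> A - \<psi> A) $$ (p, q)"
        using toeplitz_linearD(1)[OF lin A] toeplitz_linearD(1)[OF lin\<psi> A] pq by simp
      then show ?thesis unfolding R1(2)[OF A pq] R2(2)[OF A pq] split[of "\<lambda>r. row_form d r A p q"] .
    qed
    have dens: "cnj (poly (f p) z) * poly (f q) z = (\<Sum>l<m1 + m2. cnj (poly (R l p) z) * poly (R l q) z)"
      if z: "cmod z = 1" and pq: "p < n" "q < n" for p q z
      using poly_density_row_forms[OF pq z degR degR \<phi>R] pq
      unfolding density[OF z] row_eval_density[OF Q(1) pq] f_def by simp
    \<comment> \<open>Contracting the density identity with c writes the squared modulus for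
      \<open>f\<close> as the sum of the squared moduli for all the rows \<open>R l\<close>, so it
      bounds each of them.\<close>
    have dom: "cmod (\<Sum>k<n. c k * poly (R l k) z) \<le> cmod (\<Sum>k<n. c k * poly (f k) z)"
      if z: "cmod z = 1" and l: "l < m1 + m2" for l z c
    proof -
      have sq: "of_real ((cmod (\<Sum>k<n. c k * poly (h k) z))\<^sup>2)
          = (\<Sum>p<n. \<Sum>q<n. cnj (c p) * c q * (cnj (poly (h p) z) * poly (h q) z))" for h
      proof -
        have "of_real ((cmod (\<Sum>k<n. c k * poly (h k) z))\<^sup>2)
            = cnj (\<Sum>k<n. c k * poly (h k) z) * (\<Sum>k<n. c k * poly (h k) z)"
          by (simp only: complex_norm_square mult.commute)
        also have "\<dots> = (\<Sum>p<n. \<Sum>q<n. cnj (c p) * c q * (cnj (poly (h p) z) * poly (h q) z))"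
          unfolding cnj_sum sum_product by (intro sum.cong refl) (simp add: mult_ac)
        finally show ?thesis .
      qed
      have "complex_of_real ((cmod (\<Sum>k<n. c k * poly (f k) z))\<^sup>2)
          = (\<Sum>p<n. \<Sum>q<n. \<Sum>l<m1 + m2. cnj (c p) * c q * (cnj (poly (R l p) z) * poly (R l q) z))"
        unfolding sq using dens[OF z] by (intro sum.cong refl) (simp add: sum_distrib_left)
      also have "\<dots> = (\<Sum>p<n. \<Sum>l<m1 + m2. \<Sum>q<n. cnj (c p) * c q * (cnj (poly (R l p) z) * poly (R l q) z))"
        by (intro sum.cong refl sum.swap)
      also have "\<dots> = (\<Sum>l<m1 + m2. \<Sum>p<n. \<Sum>q<n. cnj (c p) * c q * (cnj (poly (R l p) z) * poly (R l q) z))"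
        by (rule sum.swap)
      also have "\<dots> = of_real (\<Sum>l<m1 + m2. (cmod (\<Sum>k<n. c k * poly (R l k) z))\<^sup>2)"
        unfolding of_real_sum sq ..
      finally have "(cmod (\<Sum>k<n. c k * poly (f k) z))\<^sup>2 = (\<Sum>l<m1 + m2. (cmod (\<Sum>k<n. c k * poly (R l k) z))\<^sup>2)"
        by (simp only: of_real_eq_iff)
      moreover have "(cmod (\<Sum>k<n. c k * poly (R l k) z))\<^sup>2 \<le> (\<Sum>l<m1 + m2. (cmod (\<Sum>k<n. c k * poly (R l k) z))\<^sup>2)"
        using l by (intro member_le_sum) auto
      ultimately show ?thesis by (metis norm_ge_zero power2_le_imp_le)
    qed
    have "\<exists>c. \<forall>k<n. R l k = smult c (f k)" if l: "l < m1 + m2" for l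
    proof (rule row_dominated_imp_proportional[where q = f, OF groots j])
      show "degree (R l k) \<le> d - 1" for k using degR[of l k] by simp
    qed (use dom l in auto)
    then obtain c where c: "\<And>l k. l < m1 + m2 \<Longrightarrow> k < n \<Longrightarrow> R l k = smult (c l) (f k)" by metis
    have Rf: "row_form d (R l) A p q = of_real ((cmod (c l))\<^sup>2) * row_form d f A p q"
      if "l < m1 + m2" "p < n" "q < n" for l A p q
    proof -
      have "row_form d (R l) A p q = row_form d (\<lambda>p. smult (c l) (f p)) A p q"
        using that c by (intro row_form_cong) auto
      then show ?thesis by (simp only: row_form_smult_row complex_norm_square)
    qed
    \<comment> \<open>Every row is a multiple of \<open>f\<close>, so \<open>\<psi>\<close> and
      \<open>\<phi>\<close> are \<open>T1\<close> and \<open>T\<close> times the compression by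
      \<open>f\<close>, and the wanted scalar is \<open>T1 / T\<close>; \<open>T\<close> is nonzero
      because \<open>\<phi>\<close> is unital.\<close>
    define T1 where "T1 = (\<Sum>l<m1. (cmod (c l))\<^sup>2)"
    define T where "T = (\<Sum>l<m1 + m2. (cmod (c l))\<^sup>2)"
    have T1: "0 \<le> T1" "T1 \<le> T" by (auto simp: T1_def T_def intro!: sum_nonneg sum_mono2)
    have \<phi>T: "\<phi> A $$ (p, q) = of_real T * row_form d f A p q" if "A \<in> toeplitz d" "p < n" "q < n" for A p q
      unfolding \<phi>R[OF that] T_def using that by (simp add: Rf sum_distrib_right)
    have \<psi>T: "\<psi> A $$ (p, q) = of_real T1 * row_form d f A p q" if "A \<in> toeplitz d" "p < n" "q < n" for A p q
    proof -
      have "row_form d (R1 l) A p q = of_real ((cmod (c l))\<^sup>2) * row_form d f A p q" if "l < m1" for l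
        using Rf[of l p q A] that \<open>p < n\<close> \<open>q < n\<close> by (simp add: R_def)
      then show ?thesis unfolding R1(2)[OF that] T1_def by (simp add: sum_distrib_right)
    qed
    have "T \<noteq> 0" using \<phi>T[OF toeplitz_one, of 0 0] n unit by auto
    with T1 have "T > 0" by simp
    have "\<psi> A = of_real (T1 / T) \<cdot>\<^sub>m \<phi> A" if A: "A \<in> toeplitz d" for A
      using toeplitz_linearD(1)[OF lin A] toeplitz_linearD(1)[OF lin\<psi> A] \<open>T > 0\<close>
      by (intro eq_matI) (auto simp: \<phi>T[OF A] \<psi>T[OF A])
    then show ?thesis using T1 \<open>T > 0\<close> by (intro exI[of _ "T1 / T"]) auto
  qed
  moreover have "\<phi> (1\<^sub>m d) \<noteq> 0\<^sub>m n n"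
  proof
    assume "\<phi> (1\<^sub>m d) = 0\<^sub>m n n"
    then have "1\<^sub>m n $$ (0, 0) = (0\<^sub>m n n $$ (0, 0) :: complex)" using unit by simp
    then show False using n by simp
  qed
  ultimately show ?thesis using cp toeplitz_one unfolding pure_cp_map_def by blast
qed

lemma row_if_pure:
  assumes d: "1 \<le> d" and n: "1 \<le> n" and ucp: "ucp_map d n \<phi>" and pure: "pure_cp_map d n \<phi>"
  shows "\<exists>Q. Q \<in> carrier_mat 1 n \<and> Q \<noteq> 0\<^sub>m 1 n \<and> row_degree Q = d - 1 \<and>
    (\<forall>z. cmod z = 1 \<longrightarrow> poly_density d n \<phi> z = mat_adjoint (eval_row Q z) * eval_row Q z) \<and>
    (\<forall>z. poly (row_gcd Q) z = 0 \<longrightarrow> cmod z = 1)"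
proof -
  have unit: "\<phi> (1\<^sub>m d) = 1\<^sub>m n" using ucp by (auto simp: ucp_map_def)
  obtain f where deg: "\<And>p. degree (f p) < d"
    and f: "\<And>A p q. A \<in> toeplitz d \<Longrightarrow> p < n \<Longrightarrow> q < n \<Longrightarrow> \<phi> A $$ (p, q) = row_form d f A p q"
    using pure_imp_single_row[OF d pure] by blast
  obtain k where k: "k < n" "f k \<noteq> 0"
  proof -
    have "row_form d f (1\<^sub>m d) 0 0 \<noteq> 0" using f[OF toeplitz_one, of 0 0] n unit by simp
    then have "f 0 \<noteq> 0" by (auto simp: row_form_def)
    then show ?thesis using that[of 0] n by simp
  qed
  \<comment> \<open>If all entries lose a degree, either through a defect or through a common zero, the factor
    split off is a sum of two squares on the circle.\<close>
  have no_split: "\<exists>t::real. cnj x1 * x1 + cnj y1 * y1 = of_real t * (cnj x * x + cnj y * y) \<and>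
      cnj x1 * y1 = of_real t * (cnj x * y)"
    if "\<And>p. p < n \<Longrightarrow> f p = [:x, y:] * w p" "\<And>p. p < n \<Longrightarrow> degree (w p) + 1 < d"
      "cnj x * x + cnj y * y = cnj x1 * x1 + cnj y1 * y1 + (cnj x2 * x2 + cnj y2 * y2)"
      "cnj x * y = cnj x1 * y1 + cnj x2 * y2" for x y x1 y1 x2 y2 w
  proof (rule pure_splitting_proportional[OF d pure _ that(2) k(1) _ that(3,4)])
    show "w k \<noteq> 0" using that(1)[OF k(1)] k(2) by auto
    fix A p q assume A: "A \<in> toeplitz d" and pq: "p < n" "q < n"
    show "\<phi> A $$ (p, q) = row_form d (\<lambda>p. [:x, y:] * w p) A p q"
      unfolding f[OF A pq] using that(1)[OF pq(1)] that(1)[OF pq(2)] by (rule row_form_cong)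
  qed
  define Q where "Q = mat 1 n (\<lambda>(_, j). f j)"
  have Q: "Q \<in> carrier_mat 1 n" by (simp add: Q_def)
  have Qf: "Q $$ (0, j) = f j" if "j < n" for j using that by (simp add: Q_def)
  have "Q $$ (0, k) \<noteq> 0\<^sub>m 1 n $$ (0, k)" using k by (simp add: Qf)
  then have "Q \<noteq> 0\<^sub>m 1 n" by auto
  moreover have "row_degree Q = d - 1"
  proof -
    have rd: "row_degree Q = Max ((\<lambda>j. degree (f j)) ` {..<n})"
      unfolding row_degree_eq[OF Q] by (intro arg_cong[where f = Max] image_cong) (auto simp: Qf)
    have "row_degree Q \<in> (\<lambda>j. degree (f j)) ` {..<n}"
      unfolding rd using n by (intro Max_in) (auto simp: lessThan_empty_iff)
    then obtain j where "row_degree Q = degree (f j)" by blast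
    then have le: "row_degree Q \<le> d - 1" using deg[of j] by simp
    show ?thesis
    proof (rule ccontr)
      assume "row_degree Q \<noteq> d - 1"
      then have lt: "row_degree Q + 1 < d" using le by simp
      have "degree (f p) + 1 < d" if "p < n" for p
      proof -
        have "degree (f p) \<le> row_degree Q" unfolding rd using that by (intro Max_ge) auto
        then show ?thesis using lt by simp
      qed
      \<comment> \<open>On the circle 1 = |1/2 + z/2|^2 + |1/2 - z/2|^2, and the first square has
        cross term 1/4 whereas the constant 1 has none.\<close>
      then obtain t :: real where "1 / 2 = complex_of_real t" "1 / 4 = complex_of_real t * 0"
        using no_split[of 1 0 f "1 / 2" "1 / 2" "1 / 2" "- 1 / 2"] by auto
      then show False by simp
    qed
  qed
  moreover have "poly_density d n \<phi> z = mat_adjoint (eval_row Q z) * eval_row Q z" if z: "cmod z = 1" for z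
  proof (rule eq_matI)
    fix p q assume "p < dim_row (mat_adjoint (eval_row Q z) * eval_row Q z)"
      "q < dim_col (mat_adjoint (eval_row Q z) * eval_row Q z)"
    then have pq: "p < n" "q < n" using Q by (auto simp: mat_adjoint_def eval_row_def)
    show "poly_density d n \<phi> z $$ (p, q) = (mat_adjoint (eval_row Q z) * eval_row Q z) $$ (p, q)"
      using poly_density_row_forms[OF pq z, where m = 1 and Q = "\<lambda>_. f" and \<phi> = \<phi>] deg f pq
      unfolding row_eval_density[OF Q pq] by (simp add: Qf)
  qed (use Q in \<open>auto simp: poly_density_def mat_adjoint_def eval_row_def\<close>)
  moreover have "cmod \<alpha> = 1" if root: "poly (row_gcd Q) \<alpha> = 0" for \<alpha>
  proof (rule ccontr)
    assume \<alpha>: "cmod \<alpha> \<noteq> 1"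
    have dvd: "[:- \<alpha>, 1:] dvd f p" if "p < n" for p
    proof -
      have "[:- \<alpha>, 1:] dvd row_gcd Q" using root by (simp add: poly_eq_0_iff_dvd)
      also have "row_gcd Q dvd f p" unfolding row_gcd_eq[OF Q] using that by (intro Gcd_dvd) (auto simp: Qf)
      finally show ?thesis .
    qed
    define w where "w p = f p div [:- \<alpha>, 1:]" for p
    have fw: "f p = [:- \<alpha>, 1:] * w p" if "p < n" for p using dvd[OF that] by (simp only: w_def dvd_mult_div_cancel)
    have degw: "degree (f p) = degree (w p) + 1" if "p < n" "f p \<noteq> 0" for p
    proof -
      have "w p \<noteq> 0" using fw[OF that(1)] that(2) by auto
      then show ?thesis unfolding fw[OF that(1)] by (subst degree_mult_eq) auto
    qed
    \<comment> \<open>Needed for the entries that vanish identically, whose quotient has degree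
      0.\<close>
    have "1 < d" using degw[OF k] deg[of k] by simp
    have deg': "degree (w p) + 1 < d" if "p < n" for p
    proof (cases "f p = 0")
      case True
      then have "w p = 0" using fw[OF that] by (metis mult_eq_0_iff one_neq_zero pCons_eq_0_iff)
      then show ?thesis using \<open>1 < d\<close> by simp
    next
      case False
      then show ?thesis using degw[OF that] deg[of p] by simp
    qed
    show False
    proof (cases "\<alpha> = 0")
      case True
      \<comment> \<open>Since |z|^2 = 1 on the circle, the factor z admits the same splitting as the
        constant 1.\<close>
      then obtain t :: real where "1 / 2 = complex_of_real t" "1 / 4 = complex_of_real t * 0"
        using no_split[of 0 1 w "1 / 2" "1 / 2" "1 / 2" "- 1 / 2"] fw deg' by auto
      then show False by simp
    next
      case False
      \<comment> \<open>With r = |\<alpha>|, on the circle |z - \<alpha>|^2 = (1 - r)^2 + r |z -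
        \<alpha>/r|^2; \<open>x2\<close> and \<open>s\<close> are the coefficients of sqrt(r) (z -
        \<alpha>/r). The first summand is constant, so its vanishing cross term forces t = 0 and
        then r = 1.\<close>
      define r where "r = cmod \<alpha>"
      have r: "r > 0" "r \<noteq> 1" using False \<alpha> by (auto simp: r_def)
      define s where "s = complex_of_real (sqrt r)"
      have s: "s * s = of_real r" "cnj s = s" using r(1) by (auto simp: s_def simp flip: of_real_mult)
      have sq: "cnj \<alpha> * \<alpha> = of_real r * of_real r"
        using complex_norm_square[of \<alpha>] by (simp add: r_def power2_eq_square mult.commute)
      define x2 where "x2 = - s * \<alpha> / of_real r"
      have x2: "cnj x2 * x2 = of_real r" "cnj x2 * s = - cnj \<alpha>"
      proof -
        have cnj_x2: "cnj x2 = - s * cnj \<alpha> / of_real r" by (simp add: x2_def s(2))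
        have "cnj x2 * x2 = (s * s) * (cnj \<alpha> * \<alpha>) / (of_real r * of_real r)"
          unfolding cnj_x2 unfolding x2_def by (simp add: mult_ac)
        then show "cnj x2 * x2 = of_real r" unfolding s sq using r(1) by simp
        have "cnj x2 * s = - (s * s) * cnj \<alpha> / of_real r" unfolding cnj_x2 by (simp add: mult_ac)
        then show "cnj x2 * s = - cnj \<alpha>" unfolding s using r(1) by simp
      qed
      have "cnj (-\<alpha>) * (-\<alpha>) + cnj 1 * 1 = cnj (of_real (1 - r)) * of_real (1 - r) + cnj 0 * 0
          + (cnj x2 * x2 + cnj s * s)"
        unfolding x2 s using sq by (simp add: algebra_simps)
      moreover have "cnj (-\<alpha>) * 1 = cnj (of_real (1 - r)) * 0 + cnj x2 * s" unfolding x2 by simp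
      ultimately obtain t :: real where
        t: "cnj (of_real (1 - r)) * of_real (1 - r) + cnj 0 * 0 = of_real t * (cnj (-\<alpha>) * (-\<alpha>) + cnj 1 * 1)"
          "cnj (of_real (1 - r)) * 0 = of_real t * (cnj (-\<alpha>) * 1)"
        using no_split[of "- \<alpha>" 1 w "of_real (1 - r)" 0 x2 s] fw deg' by blast
      from t(2) False have "t = 0" by simp
      with t(1) have "complex_of_real (1 - r) = 0" by simp
      then show False using r(2) by (simp only: of_real_eq_0_iff)
    qed
  qed
  ultimately show ?thesis using Q by blast
qed

theorem theorem1:
  fixes d n :: nat and \<phi> :: "complex mat \<Rightarrow> complex mat"
  assumes "d \<ge> 1" and "n \<ge> 1" and "ucp_map d n \<phi>"
  shows "pure_cp_map d n \<phi> \<longleftrightarrow>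
    (\<exists>Q :: complex poly mat. Q \<in> carrier_mat 1 n \<and> Q \<noteq> 0\<^sub>m 1 n \<and>
       row_degree Q = d - 1 \<and>
       (\<forall>z. cmod z = 1 \<longrightarrow> poly_density d n \<phi> z = mat_adjoint (eval_row Q z) * eval_row Q z) \<and>
       (\<forall>z. poly (row_gcd Q) z = 0 \<longrightarrow> cmod z = 1))"
  using row_if_pure[OF assms] pure_if_row[OF assms] by blast

end
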